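(* Let $t\ge 1$ be an integer and $d=2^t$. Let the dictionary $\{\phi_i\}_{i=1}^m\subset\mathbb R^d$ consist of the $d$ standard basis vectors of $\mathbb R^d$ together with any $m-d$ of the $d^2$ sign vectors $\tilde\phi_{a,b}$, $(a,b)\in\mathbb F_{2^t}\times\mathbb F_{2^t}$ (that is, the vectors $\tilde\phi_{a,b}$ for $m-d$ pairwise distinct labels $(a,b)$, where $d\le m\le d+d^2$). Then the coherence $\mu=\max_{i\neq j}|\langle\phi_i,\phi_j\rangle|$ of the dictionary satisfies $$\mu\;\le\;\frac{1+2\sqrt d}{d}\;=\;\frac{2}{\sqrt d}+\frac1d .$$
   Context: $\mathbb F_{2^t}$ is the finite field with $d=2^t$ elements. The coordinates of $\mathbb R^d$ are indexed by the $d$ elements $\xi\in\mathbb F_{2^t}$ (via any fixed bijection), and $\langle\cdot,\cdot\rangle$ is the standard Euclidean inner product. The absolute trace is $\operatorname{Tr}:\mathbb F_{2^t}\to\mathbb F_2$, $\operatorname{Tr}(y)=y+y^2+y^{2^2}+\cdots+y^{2^{t-1}}$; its value in $\mathbb F_2=\{0,1\}$ is used as an exponent of $-1$. The convention $0^{-1}=0$ is used in $\mathbb F_{2^t}$. For each pair $(a,b)\in\mathbb F_{2^t}\times\mathbb F_{2^t}$, the sign vector $\tilde\phi_{a,b}\in\mathbb R^d$ is defined by $$[\tilde\phi_{a,b}]_\xi=\frac{1}{\sqrt d}\,(-1)^{\operatorname{Tr}(a\xi+b\xi^{-1})},\qquad \xi\in\mathbb F_{2^t}.$$ This gives a family of $d^2$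 sign vectors indexed by the labels $(a,b)$. *)

theory Defs
  imports "HOL-Analysis.Analysis" "HOL-Number_Theory.Number_Theory"
begin

text \<open>
  The field with \<open>2 ^ t\<close> elements is a type of class \<open>finite_field\<close> with \<open>CARD('a) = 2 ^ t\<close>.
  Vectors are of type \<open>real ^ 'a\<close>, i.e. their coordinates are indexed by the field elements.
  The convention that the inverse of zero is zero is part of the class \<open>field\<close>.
\<close>

definition abs_trace :: "nat \<Rightarrow> 'a::finite_field \<Rightarrow> 'a" where
  "abs_trace t y = (\<Sum>i<t. y ^ (2 ^ i))"

lemma abs_trace_cases:
  fixes y :: "'a::finite_field"
  assumes "t \<ge> 1" and card: "CARD('a) = 2 ^ t"
  shows "abs_trace t y = 0 \<or> abs_trace t y = 1"
proof -
  have "CHAR('a) dvd 2 ^ t"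
    using CHAR_dvd_CARD[where 'a='a] card by simp
  moreover have prime: "prime CHAR('a)"
    by (rule prime_CHAR_semidom) (simp add: finite_imp_CHAR_pos)
  ultimately have char: "CHAR('a) = 2"
    by (metis prime_dvd_power primes_dvd_imp_eq two_is_prime_nat)
  have "abs_trace t y ^ 2 = (\<Sum>i<t. (y ^ 2 ^ i) ^ 2)"
    unfolding abs_trace_def using prime char
    by (subst freshmans_dream_sum[of 2]) simp_all
  also have "\<dots> = (\<Sum>i<t. y ^ 2 ^ Suc i)"
    by (simp add: mult.commute flip: power_mult)
  also have "\<dots> = (\<Sum>i<Suc t. y ^ 2 ^ i) - y"
    by (subst sum.lessThan_Suc_shift) simp
  also have "\<dots> = abs_trace t y"
    using finite_field_power_card_eq_same[of y] card by (simp add: abs_trace_def)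
  finally have "abs_trace t y * (abs_trace t y - 1) = 0"
    by (simp add: power2_eq_square algebra_simps)
  then show ?thesis by auto
qed

text \<open>
  Since \<open>abs_trace t\<close> takes values in the prime field \<open>{0, 1}\<close> of \<open>'a\<close>, the value can be lifted
  to the natural numbers \<open>0\<close>, \<open>1\<close> and used as an exponent.
\<close>

definition trace_exponent :: "nat \<Rightarrow> 'a::finite_field \<Rightarrow> nat" where
  "trace_exponent t y = (if abs_trace t y = 0 then 0 else 1)"

lemma of_nat_trace_exponent:
  fixes y :: "'a::finite_field"
  assumes "t \<ge> 1" "CARD('a) = 2 ^ t"
  shows "of_nat (trace_exponent t y) = abs_trace t y"
  using abs_trace_cases[OF assms, of y] by (auto simp: trace_exponent_def)

definition sign_vector :: "nat \<Rightarrow> 'a \<Rightarrow> 'a \<Rightarrow> real ^ 'a::finite_field" where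
  "sign_vector t a b =
     (\<chi> \<xi>. 1 / sqrt (real CARD('a)) * (-1) ^ trace_exponent t (a * \<xi> + b * inverse \<xi>))"

text \<open>
  A dictionary \<open>\<phi> 1, \<dots>, \<phi> m\<close> of all standard basis vectors and the sign vectors with labels in \<open>L\<close>,
  listed in an arbitrary order: \<open>\<sigma>\<close> assigns to each index either a coordinate or a label. The
  labels are used exactly once each, but different labels may give equal vectors.
\<close>

definition sign_dictionary :: "nat \<Rightarrow> nat \<Rightarrow> (nat \<Rightarrow> real ^ 'a::finite_field) \<Rightarrow> bool" where
  "sign_dictionary t m \<phi> \<longleftrightarrow>
     (\<exists>(L :: ('a \<times> 'a) set) (\<sigma> :: nat \<Rightarrow> 'a + 'a \<times> 'a).
        card L = m - CARD('a) \<and>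
        bij_betw \<sigma> {1..m} (UNIV <+> L) \<and>
        (\<forall>i\<in>{1..m}. \<phi> i = (case \<sigma> i of Inl \<xi> \<Rightarrow> axis \<xi> 1 | Inr (a, b) \<Rightarrow> sign_vector t a b)))"

text \<open>
  The maximum is meaningful only for \<open>m \<ge> 2\<close>.
\<close>

definition coherence :: "nat \<Rightarrow> (nat \<Rightarrow> 'v::real_inner) \<Rightarrow> real" where
  "coherence m \<phi> = Max {\<bar>\<phi> i \<bullet> \<phi> j\<bar> | i j. i \<in> {1..m} \<and> j \<in> {1..m} \<and> i \<noteq> j}"

end

theory Submission
  imports Defs "HOL-Algebra.Algebraic_Closure_Type"
begin

hide_const (open) up_ring.monom up_ring.coeff module.smult Polynomials.degree Polynomials.lead_coeff
  Divisibility.prime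

text \<open>
  Inner products of distinct sign vectors are complete character sums of \<open>A x + B / x\<close>; if
  \<open>A B \<noteq> 0\<close>, such a sum is \<open>1 + K\<close> for a Kloosterman sum \<open>K\<close>, and Weil's bound \<open>\<bar>K\<bar> \<le> 2 \<surd>q\<close> is needed.
  Let \<open>K\<^sub>s\<close> be the sum over the field with \<open>q = 2 ^ s\<close> elements. Counting pairs by sum and product
  gives \<open>K\<^sub>2\<^sub>s = 2 q - K\<^sub>s\<^sup>2\<close>. If \<open>K\<^sub>s\<^sup>2 > 4 q\<close>, iterating this makes \<open>K\<^sub>n / 2 ^ (n / 2)\<close> tend to
  \<open>- \<infinity>\<close> along \<open>n = s, 2 s, 4 s, \<dots>\<close>. This contradicts a bound \<open>K\<^sub>2\<^sub>h \<ge> - 5 \<cdot> 2 ^ h\<close>, which follows from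
  Bombieri's form of the Stepanov method on the curve \<open>y\<^sup>2 + y = A x + B / x\<close>: a nonzero function
  with few poles, obtained from a dimension count, vanishes at all points with
  \<open>x \<in> F\<^sub>2\<^sub>h\<close> where \<open>A x + B / x\<close> has trace one.
\<close>

section \<open>Finite fields of characteristic two inside an algebraically closed field\<close>

text \<open>
  The fields \<open>F\<^sub>s\<close> with \<open>2 ^ s\<close> elements are treated as subsets of one algebraically closed field,
  so that the whole tower of extensions lives in a single type.
\<close>

definition frobenius_fixed :: "nat \<Rightarrow> 'k::field set" where
  "frobenius_fixed s = {x. x ^ 2 ^ s = x}"

definition trace_poly :: "nat \<Rightarrow> 'k::field \<Rightarrow> 'k" where
  "trace_poly s z = (\<Sum>i<s. z ^ 2 ^ i)"

text \<open>The default value -1 is meant for arguments in \<open>frobenius_fixed s\<close>: there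
  the trace is 0 or 1 and this is an additive character.\<close>

definition trace_character :: "nat \<Rightarrow> 'k::field \<Rightarrow> real" where
  "trace_character s z = (if trace_poly s z = 0 then 1 else -1)"

definition kloosterman_sum :: "nat \<Rightarrow> 'k::field \<Rightarrow> 'k \<Rightarrow> real" where
  "kloosterman_sum s A B =
     (\<Sum>x\<in>frobenius_fixed s - {0}. trace_character s (A * x + B * inverse x))"

text \<open>A repeated root would also be a root of the derivative, so the linear factors of
  \<open>p\<close> are pairwise distinct.\<close>

lemma card_nonzero_roots_separable:
  fixes p :: "'k::alg_closed_field poly"
  assumes "p \<noteq> 0" and separable: "\<And>x. poly p x = 0 \<Longrightarrow> poly (pderiv p) x \<noteq> 0"
  shows "card {x. poly p x = 0} = degree p"
proof -
  obtain R where R: "size R = degree p" "p = smult (lead_coeff p) (\<Prod>x\<in>#R. [:-x, 1:])"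
    using alg_closed_imp_factorization[OF assms(1)] by blast
  have lc: "lead_coeff p \<noteq> 0"
    using assms(1) by simp
  have "count R x \<le> 1" for x
  proof (rule ccontr)
    assume "\<not> count R x \<le> 1"
    then have "replicate_mset 2 x \<subseteq># R"
      by (simp flip: count_le_replicate_mset_subset_eq)
    then obtain R' where R': "R = add_mset x (add_mset x R')"
      by (auto simp: mset_subset_eq_exists_conv numeral_2_eq_2)
    define q where "q = smult (lead_coeff p) (\<Prod>y\<in>#R'. [:-y, 1:])"
    have "p = [:-x, 1:] * ([:-x, 1:] * q)"
      by (subst R(2)) (simp add: R' q_def)
    then have "poly p x = 0" "poly (pderiv p) x = 0"
      by (simp_all only: pderiv_mult poly_mult poly_add) simp_all
    then show False
      using separable by blast
  qed
  then have "count R x = count (mset_set (set_mset R)) x" for x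
    by (cases "x \<in># R") (simp_all add: not_in_iff le_antisym Suc_le_eq)
  then have "R = mset_set (set_mset R)"
    by (rule multiset_eqI)
  then have "size R = card (set_mset R)"
    by (metis size_mset_set)
  moreover have "poly p x = 0 \<longleftrightarrow> x \<in># R" for x
    by (subst R(2)) (use lc in \<open>auto simp: poly_prod_mset prod_mset_zero_iff\<close>)
  ultimately show ?thesis
    using R(1) by simp
qed

section \<open>Characteristic-two arithmetic, traces and characters\<close>

context
  fixes dummy :: "'k::field itself"
  assumes char2: "CHAR('k) = 2"
begin

lemma add_self_char2: "x + x = (0::'k)"
  using minus_CHAR_2[OF char2, of x x] by simp

lemma add_add_self_char2: "x + (x + y) = (y::'k)"
  by (simp add: add_self_char2 flip: add.assoc)

lemma add_eq_0_iff_char2: "x + y = 0 \<longleftrightarrow> x = (y::'k)"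
  using minus_CHAR_2[OF char2, of x y] by (metis eq_iff_diff_eq_0)

lemma frobenius_add: "(x + y) ^ 2 ^ n = x ^ 2 ^ n + (y::'k) ^ 2 ^ n"
  by (rule freshmans_dream') (simp_all add: char2)

lemma frobenius_square_add: "(x + y)\<^sup>2 = x\<^sup>2 + (y::'k)\<^sup>2"
  using frobenius_add[of x y 1] by simp

lemma frobenius_sum: "sum f S ^ 2 ^ n = (\<Sum>i\<in>S. (f i::'k) ^ 2 ^ n)"
  by (rule freshmans_dream_sum') (simp_all add: char2)

lemma frobenius_poly_add: "(p + q) ^ 2 ^ n = p ^ 2 ^ n + (q::'k poly) ^ 2 ^ n"
  by (rule freshmans_dream') (simp_all add: char2)

lemma frobenius_fixed_0: "0 \<in> frobenius_fixed s"
  and frobenius_fixed_1: "1 \<in> frobenius_fixed s"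
  by (simp_all add: frobenius_fixed_def)

lemma frobenius_fixed_add:
  "x \<in> frobenius_fixed s \<Longrightarrow> y \<in> frobenius_fixed s \<Longrightarrow> x + (y::'k) \<in> frobenius_fixed s"
  by (simp add: frobenius_fixed_def frobenius_add)

lemma frobenius_fixed_mult:
  "x \<in> frobenius_fixed s \<Longrightarrow> y \<in> frobenius_fixed s \<Longrightarrow> x * (y::'k) \<in> frobenius_fixed s"
  by (simp add: frobenius_fixed_def power_mult_distrib)

lemma frobenius_fixed_inverse:
  "x \<in> frobenius_fixed s \<Longrightarrow> inverse (x::'k) \<in> frobenius_fixed s"
  by (simp add: frobenius_fixed_def power_inverse)

lemma frobenius_fixed_double:
  "x \<in> frobenius_fixed s \<Longrightarrow> (x::'k) \<in> frobenius_fixed (2 * s)"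
  by (simp add: frobenius_fixed_def mult_2 power_add power_mult)

lemma trace_poly_add: "trace_poly s (x + y) = trace_poly s x + trace_poly s (y::'k)"
  by (simp add: trace_poly_def frobenius_add sum.distrib)

lemma trace_poly_square: "trace_poly s (x\<^sup>2) = (trace_poly s (x::'k))\<^sup>2"
  using frobenius_sum[of "\<lambda>i. x ^ 2 ^ i" "{..<s}" 1]
  by (simp add: trace_poly_def mult.commute flip: power_mult)

text \<open>The terms telescope. The identity is later applied to roots of
  \<open>y ^ 2 + y = f\<close>, which may lie outside the field.\<close>

lemma trace_poly_artin_schreier: "trace_poly s (x\<^sup>2 + x) = x ^ 2 ^ s + (x::'k)"
proof (induction s)
  case 0
  then show ?case by (simp add: trace_poly_def add_self_char2)
next
  case (Suc s)
  have "trace_poly (Suc s) (x\<^sup>2 + x) = x ^ 2 ^ s + x + (x\<^sup>2 + x) ^ 2 ^ s"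
    using Suc.IH by (simp add: trace_poly_def)
  also have "\<dots> = x ^ 2 ^ Suc s + x"
    by (simp add: frobenius_add add_self_char2 add_add_self_char2 add_ac flip: power_mult)
  finally show ?case .
qed

text \<open>With \<open>T\<close> the trace of \<open>z\<close>,
  \<open>T ^ 2 + T = z ^ 2 ^ s + z = 0\<close>.\<close>

lemma trace_poly_fixed_cases:
  assumes "(z::'k) \<in> frobenius_fixed s"
  shows "trace_poly s z = 0 \<or> trace_poly s z = 1"
proof -
  have "(trace_poly s z)\<^sup>2 + trace_poly s z = z ^ 2 ^ s + z"
    using trace_poly_artin_schreier[of s z] by (simp add: trace_poly_add trace_poly_square)
  also have "\<dots> = 0"
    using assms by (simp add: frobenius_fixed_def add_self_char2)
  finally have "trace_poly s z * (trace_poly s z + 1) = 0"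
    by (simp add: power2_eq_square algebra_simps)
  then show ?thesis
    by (auto simp: add_eq_0_iff_char2)
qed

lemma trace_character_add:
  assumes "x \<in> frobenius_fixed s" "(y::'k) \<in> frobenius_fixed s"
  shows "trace_character s (x + y) = trace_character s x * trace_character s y"
  using trace_poly_fixed_cases[OF assms(1)] trace_poly_fixed_cases[OF assms(2)]
  by (auto simp: trace_character_def trace_poly_add add_self_char2)

text \<open>Transitivity of the trace: for \<open>z\<close> in \<open>F\<^sub>2\<^sub>s\<close>,
  \<open>z + z ^ 2 ^ s\<close> is the relative trace to \<open>F\<^sub>s\<close>.\<close>

lemma trace_poly_double: "trace_poly (2 * s) z = trace_poly s (z + (z::'k) ^ 2 ^ s)"
proof -
  have "trace_poly (2 * s) z = (\<Sum>i<s. z ^ 2 ^ i) + (\<Sum>i\<in>{s..<s+s}. z ^ 2 ^ i)"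
    unfolding trace_poly_def lessThan_atLeast0 mult_2 by (rule sum.atLeastLessThan_concat[symmetric]) auto
  also have "(\<Sum>i\<in>{s..<s+s}. z ^ 2 ^ i) = (\<Sum>i<s. (z ^ 2 ^ s) ^ 2 ^ i)"
    using sum.shift_bounds_nat_ivl[of "\<lambda>i. z ^ 2 ^ i" 0 s s]
    by (simp add: lessThan_atLeast0 power_add mult.commute flip: power_mult)
  finally show ?thesis
    by (simp add: trace_poly_def trace_poly_add[unfolded trace_poly_def])
qed

end

section \<open>Size of the fixed fields and orthogonality of characters\<close>

context
  fixes dummy :: "'k::alg_closed_field itself"
  assumes char2: "CHAR('k) = 2"
begin

text \<open>These are the roots of \<open>X ^ 2 ^ s - X\<close>, whose derivative is the constant
  -1.\<close>

lemma card_frobenius_fixed: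
  assumes "s \<ge> 1"
  shows "card (frobenius_fixed s :: 'k set) = 2 ^ s"
proof -
  define p :: "'k poly" where "p = monom 1 (2 ^ s) - [:0, 1:]"
  have s: "(2::nat) ^ s > 1"
    using assms one_less_power[of "2::nat" s] by simp
  have deg: "degree p = 2 ^ s"
    unfolding p_def diff_conv_add_uminus
    by (subst degree_add_eq_left) (use s in \<open>simp_all add: degree_monom_eq\<close>)
  have "pderiv p = - 1"
  proof -
    have "(of_nat (2 ^ s) :: 'k) = 0"
      using assms by (subst of_nat_eq_0_iff_char_dvd) (simp add: char2)
    then have "pderiv (monom (1::'k) (2 ^ s)) = 0"
      by (simp add: pderiv_monom)
    then show ?thesis
      by (simp add: p_def pderiv_diff pderiv_pCons one_pCons)
  qed
  then have "card {x. poly p x = 0} = degree p"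
    using deg s by (intro card_nonzero_roots_separable) auto
  moreover have "{x. poly p x = 0} = (frobenius_fixed s :: 'k set)"
    by (auto simp: p_def frobenius_fixed_def poly_monom)
  ultimately show ?thesis
    using deg by simp
qed

lemma finite_frobenius_fixed:
  "s \<ge> 1 \<Longrightarrow> finite (frobenius_fixed s :: 'k set)"
  by (rule card_ge_0_finite) (simp add: card_frobenius_fixed)

text \<open>The trace is a nonzero polynomial of degree at most \<open>2 ^ (s - 1)\<close>, too
  small to vanish on all \<open>2 ^ s\<close> elements.\<close>

lemma trace_poly_nonzero_exists:
  assumes "s \<ge> 1"
  shows "\<exists>z\<in>frobenius_fixed s. trace_poly s (z::'k) \<noteq> 0"
proof (rule ccontr)
  assume neg: "\<not> ?thesis"
  define p :: "'k poly" where "p = (\<Sum>i<s. monom 1 (2 ^ i))"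
  have poly_p: "poly p z = trace_poly s z" for z
    by (simp add: p_def trace_poly_def poly_sum poly_monom)
  have "coeff p (2 ^ 0) = (\<Sum>i<s. if i = 0 then 1 else 0)"
    unfolding p_def coeff_sum by (intro sum.cong) auto
  also have "\<dots> = 1"
    using assms by simp
  finally have p0: "p \<noteq> 0"
    by auto
  have "degree p \<le> 2 ^ (s - 1)"
    unfolding p_def
    by (intro degree_sum_le) (auto simp: degree_monom_eq intro!: power_increasing)
  moreover have "card (frobenius_fixed s :: 'k set) \<le> card {z. poly p z = 0}"
    using neg p0 by (intro card_mono poly_roots_finite) (auto simp: poly_p)
  moreover have "card {z. poly p z = 0} \<le> degree p"
    using p0 by (rule card_poly_roots_bound)
  ultimately have "(2::nat) ^ s \<le> 2 ^ (s - 1)"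
    unfolding card_frobenius_fixed[OF assms] by linarith
  then have "s \<le> s - 1"
    by (subst (asm) power_increasing_iff) simp_all
  then show False
    using assms by simp
qed

text \<open>For \<open>c \<noteq> 0\<close>, translation by some \<open>w\<close> with
  \<open>c * w\<close> of nonzero trace permutes the field and flips the sign of every
  summand.\<close>

lemma sum_trace_character:
  assumes "s \<ge> 1" "c \<in> frobenius_fixed s"
  shows "(\<Sum>x\<in>frobenius_fixed s. trace_character s (c * (x::'k))) = (if c = 0 then 2 ^ s else 0)"
proof (cases "c = 0")
  case True
  then show ?thesis
    using assms card_frobenius_fixed[of s] by (simp add: trace_character_def trace_poly_def power_0_left)
next
  case False
  let ?S = "\<Sum>x\<in>frobenius_fixed s. trace_character s (c * x)"
  obtain z :: 'k where z: "z \<in> frobenius_fixed s" "trace_poly s z \<noteq> 0"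
    using trace_poly_nonzero_exists[OF assms(1)] by blast
  define w where "w = inverse c * z"
  have w: "w \<in> frobenius_fixed s" "c * w = z"
    using z False assms frobenius_fixed_mult[OF char2] frobenius_fixed_inverse[OF char2]
    by (auto simp: w_def)
  have "?S = (\<Sum>x\<in>frobenius_fixed s. trace_character s (c * (x + w)))"
    by (rule sum.reindex_bij_witness[of _ "\<lambda>x. x + w" "\<lambda>x. x + w"])
      (use w in \<open>auto simp: frobenius_fixed_add[OF char2] add_self_char2[OF char2] add.assoc\<close>)
  also have "\<dots> = (\<Sum>x\<in>frobenius_fixed s. - trace_character s (c * x))"
  proof (rule sum.cong)
    fix x :: 'k assume "x \<in> frobenius_fixed s"
    then have "trace_character s (c * (x + w)) = trace_character s (c * x) * trace_character s z"
      using z assms w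
      by (simp add: distrib_left trace_character_add[OF char2] frobenius_fixed_mult[OF char2])
    then show "trace_character s (c * (x + w)) = - trace_character s (c * x)"
      using z by (simp add: trace_character_def)
  qed simp
  finally have "?S = - ?S"
    by (simp add: sum_negf)
  with False show ?thesis by simp
qed

end

section \<open>Kloosterman sums over quadratic extensions\<close>

context
  fixes dummy :: "'k::alg_closed_field itself"
  assumes char2: "CHAR('k) = 2"
begin

text \<open>
  The two summands count the ways in which \<open>X\<^sup>2 + \<sigma> X + p\<close> factors over \<open>F\<^sub>s\<close> and the conjugate
  pairs of roots in the quadratic extension; the polynomial has two roots in either case.
\<close>

lemma card_sum_product_fibres:
  fixes \<sigma> p :: 'k
  assumes "\<sigma> \<in> frobenius_fixed s" "p \<in> frobenius_fixed s - {0}"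
  shows "card {u \<in> (frobenius_fixed s - {0}) \<times> (frobenius_fixed s - {0}).
               (fst u + snd u, fst u * snd u) = (\<sigma>, p)} +
         card {z \<in> frobenius_fixed (2 * s) - {0}. (z + z ^ 2 ^ s, z * z ^ 2 ^ s) = (\<sigma>, p)} = 2"
    (is "card ?P + card ?Z = 2")
proof -
  note char2_simps = add_self_char2[OF char2] add_add_self_char2[OF char2]
  have "degree [:p, \<sigma>, 1:] > 0"
    by simp
  then obtain r where "poly [:p, \<sigma>, 1:] r = 0"
    using alg_closed_imp_poly_has_root by blast
  then have r: "p + r * (\<sigma> + r) = 0"
    by simp
  define r' where "r' = r + \<sigma>"
  have r': "r * r' = p"
    using r add_eq_0_iff_char2[OF char2, of p "r * (\<sigma> + r)"] by (simp add: r'_def add.commute)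
  then have nz: "r \<noteq> 0" "r' \<noteq> 0"
    using assms by auto
  have sum: "r + r' = \<sigma>"
    by (simp add: r'_def char2_simps)
  \<comment> \<open>Vieta: \<open>(x + r) * (x + r')\<close> vanishes, because \<open>r\<close> and
    \<open>r'\<close> have the same sum and product as \<open>x\<close> and
    \<open>y\<close>.\<close>
  have pair: "x = r \<and> y = r' \<or> x = r' \<and> y = r" if "x + y = \<sigma>" "x * y = p" for x y
  proof -
    have "x * x + x * r + (x * r' + r * r') = x * (x + (r + r') + y) + (r * r' + x * y)"
      by (simp add: algebra_simps char2_simps)
    also have "\<dots> = 0"
      using that r' sum by (simp add: add_ac char2_simps)
    finally have "(x + r) * (x + r') = 0"
      by (simp add: algebra_simps)
    moreover have "y = x + \<sigma>"
      using that(1) by (auto simp: char2_simps)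
    ultimately show ?thesis
      using sum by (auto simp: add_eq_0_iff_char2[OF char2] char2_simps add_ac)
  qed
  have \<sigma>: "\<sigma> ^ 2 ^ s = \<sigma>" and p: "p ^ 2 ^ s = p"
    using assms by (simp_all add: frobenius_fixed_def)
  show ?thesis
  proof (cases "r \<in> frobenius_fixed s")
    case True
    then have r'F: "r' \<in> frobenius_fixed s"
      using assms by (simp add: r'_def frobenius_fixed_add[OF char2])
    have "?P \<subseteq> {(r, r'), (r', r)}"
    proof
      fix u assume "u \<in> ?P"
      then have "fst u + snd u = \<sigma>" "fst u * snd u = p"
        by auto
      from pair[OF this] show "u \<in> {(r, r'), (r', r)}"
        by (cases u) auto
    qed
    then have P: "?P = {(r, r'), (r', r)}"
      using True r'F nz r' sum by (auto simp: add.commute mult.commute)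
    have rr: "r ^ 2 ^ s = r" "r' ^ 2 ^ s = r'"
      using True r'F by (simp_all add: frobenius_fixed_def)
    have "z = r \<or> z = r'" if "z \<in> ?Z" for z
      using that pair[of z "z ^ 2 ^ s"] by auto
    moreover have "r \<in> ?Z \<longleftrightarrow> r = r'" "r' \<in> ?Z \<longleftrightarrow> r = r'"
      using rr nz r' sum frobenius_fixed_double[OF char2 True]
      by (auto simp: char2_simps add_eq_0_iff_char2[OF char2])
    \<comment> \<open>Two distinct roots in \<open>F\<^sub>s\<close> give two ordered pairs; a
      double root, where \<open>\<sigma> = 0\<close>, gives one pair and one
      \<open>z\<close>.\<close>
    ultimately have Z: "?Z = (if r = r' then {r} else {})"
      by (auto split: if_splits)
    show ?thesis
      unfolding P Z by auto
  next
    case False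
    then have r'F: "r' \<notin> frobenius_fixed s"
      using assms frobenius_fixed_add[OF char2, of r' s \<sigma>]
      by (auto simp: r'_def char2_simps add.assoc)
    \<comment> \<open>Frobenius preserves sum and product, so it permutes the roots; as it does not
      fix \<open>r\<close>, it swaps them.\<close>
    have "r ^ 2 ^ s + r' ^ 2 ^ s = \<sigma>" "r ^ 2 ^ s * r' ^ 2 ^ s = p"
      using \<sigma> p r' sum by (simp_all flip: frobenius_add[OF char2] power_mult_distrib)
    from pair[OF this] have rr: "r ^ 2 ^ s = r'" "r' ^ 2 ^ s = r"
      using False by (auto simp: frobenius_fixed_def)
    have P: "?P = {}"
      using False r'F pair by fastforce
    have "r \<in> frobenius_fixed (2 * s)" "r' \<in> frobenius_fixed (2 * s)"
      using rr by (simp_all add: frobenius_fixed_def mult_2 power_add power_mult)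
    then have "r \<in> ?Z" "r' \<in> ?Z"
      using rr nz r' sum by (simp_all add: add.commute mult.commute)
    moreover have "z = r \<or> z = r'" if "z \<in> ?Z" for z
      using that pair[of z "z ^ 2 ^ s"] by auto
    ultimately have Z: "?Z = {r, r'}"
      by blast
    show ?thesis
      unfolding P Z using rr False by (auto simp: frobenius_fixed_def)
  qed
qed

text \<open>The summands of the squared sum depend only on sum and product of the two variables,
  those of the double sum in the same way on relative trace and norm of \<open>z\<close>. Together
  each \<open>(\<sigma>, p)\<close> is hit twice, and orthogonality in \<open>\<sigma>\<close>
  leaves only \<open>p = B / A\<close>.\<close>

lemma kloosterman_sum_double:
  fixes A B :: 'k
  assumes s: "s \<ge> 1" and AB: "A \<in> frobenius_fixed s" "B \<in> frobenius_fixed s" "A \<noteq> 0" "B \<noteq> 0"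
  shows "kloosterman_sum (2 * s) A B = 2 * 2 ^ s - (kloosterman_sum s A B)\<^sup>2"
proof -
  define F :: "'k set" where "F = frobenius_fixed s"
  define F2 :: "'k set" where "F2 = frobenius_fixed (2 * s)"
  \<comment> \<open>For \<open>\<sigma> = x + y\<close> and \<open>p = x * y\<close>,
    \<open>1 / x + 1 / y = \<sigma> / p\<close>.\<close>
  define \<psi> where "\<psi> = (\<lambda>v::'k \<times> 'k. trace_character s ((A + B * inverse (snd v)) * fst v))"
  note closed = frobenius_fixed_add[OF char2] frobenius_fixed_mult[OF char2]
    frobenius_fixed_inverse[OF char2]
  have fin: "finite F" "finite F2"
    using s finite_frobenius_fixed[OF char2] by (simp_all add: F_def F2_def)
  have "(kloosterman_sum s A B)\<^sup>2 =
      (\<Sum>u\<in>(F - {0}) \<times> (F - {0}). trace_character s (A * fst u + B * inverse (fst u)) *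
         trace_character s (A * snd u + B * inverse (snd u)))"
    by (simp add: power2_eq_square kloosterman_sum_def F_def sum_product sum.cartesian_product case_prod_beta)
  also have "\<dots> = (\<Sum>u\<in>(F - {0}) \<times> (F - {0}). \<psi> (fst u + snd u, fst u * snd u))"
  proof (rule sum.cong)
    fix u assume u: "u \<in> (F - {0}) \<times> (F - {0})"
    have "inverse (fst u * snd u) * (fst u + snd u) = inverse (fst u) + inverse (snd u)"
      using u by (cases u) (simp add: inverse_add mult_ac)
    then have "(A + B * inverse (fst u * snd u)) * (fst u + snd u) =
        A * (fst u + snd u) + B * (inverse (fst u) + inverse (snd u))"
      by (simp only: distrib_right mult.assoc)
    then have "\<psi> (fst u + snd u, fst u * snd u) =
        trace_character s ((A * fst u + B * inverse (fst u)) + (A * snd u + B * inverse (snd u)))"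
      unfolding \<psi>_def fst_conv snd_conv by (simp only: distrib_left add_ac)
    also have "\<dots> = trace_character s (A * fst u + B * inverse (fst u)) *
         trace_character s (A * snd u + B * inverse (snd u))"
      using u AB by (intro trace_character_add[OF char2]) (auto simp: F_def intro!: closed)
    finally show "trace_character s (A * fst u + B * inverse (fst u)) *
         trace_character s (A * snd u + B * inverse (snd u)) = \<psi> (fst u + snd u, fst u * snd u)" ..
  qed simp
  also have "\<dots> = (\<Sum>v\<in>F \<times> (F - {0}).
      of_nat (card {u \<in> (F - {0}) \<times> (F - {0}). (fst u + snd u, fst u * snd u) = v}) * \<psi> v)"
    using fin by (intro sum_fun_comp) (auto simp: F_def intro!: closed)
  finally have K1: "(kloosterman_sum s A B)\<^sup>2 = \<dots>" .
  have "kloosterman_sum (2 * s) A B = (\<Sum>z\<in>F2 - {0}. \<psi> (z + z ^ 2 ^ s, z * z ^ 2 ^ s))"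
    unfolding kloosterman_sum_def F2_def
  proof (rule sum.cong)
    fix z :: 'k assume z: "z \<in> frobenius_fixed (2 * s) - {0}"
    have "A * z + B * inverse z + (A * z + B * inverse z) ^ 2 ^ s =
        (A + B * inverse (z * z ^ 2 ^ s)) * (z + z ^ 2 ^ s)"
      using AB z
      by (simp add: frobenius_add[OF char2] power_mult_distrib frobenius_fixed_def field_simps)
    then show "trace_character (2 * s) (A * z + B * inverse z) = \<psi> (z + z ^ 2 ^ s, z * z ^ 2 ^ s)"
      by (simp add: \<psi>_def trace_character_def trace_poly_double[OF char2])
  qed simp
  also have "\<dots> = (\<Sum>v\<in>F \<times> (F - {0}).
      of_nat (card {z \<in> F2 - {0}. (z + z ^ 2 ^ s, z * z ^ 2 ^ s) = v}) * \<psi> v)"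
  proof (rule sum_fun_comp)
    show "(\<lambda>z. (z + z ^ 2 ^ s, z * z ^ 2 ^ s)) ` (F2 - {0}) \<subseteq> F \<times> (F - {0})"
    proof safe
      fix z :: 'k assume "z \<in> F2"
      then have "(z ^ 2 ^ s) ^ 2 ^ s = z"
        by (simp add: F2_def frobenius_fixed_def mult_2 power_add power_mult)
      then show "z + z ^ 2 ^ s \<in> F" "z * z ^ 2 ^ s \<in> F"
        by (simp_all add: F_def frobenius_fixed_def frobenius_add[OF char2] power_mult_distrib
            add.commute mult.commute)
    qed simp_all
  qed (use fin in auto)
  finally have "(kloosterman_sum s A B)\<^sup>2 + kloosterman_sum (2 * s) A B =
      (\<Sum>v\<in>F \<times> (F - {0}).
        of_nat (card {u \<in> (F - {0}) \<times> (F - {0}). (fst u + snd u, fst u * snd u) = v} +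
          card {z \<in> F2 - {0}. (z + z ^ 2 ^ s, z * z ^ 2 ^ s) = v}) * \<psi> v)"
    unfolding K1 by (simp add: sum.distrib distrib_right)
  also have "\<dots> = (\<Sum>v\<in>F \<times> (F - {0}). 2 * \<psi> v)"
  proof (rule sum.cong)
    fix v assume "v \<in> F \<times> (F - {0})"
    then obtain \<sigma> p where v: "v = (\<sigma>, p)" "\<sigma> \<in> F" "p \<in> F - {0}"
      by blast
    show "of_nat (card {u \<in> (F - {0}) \<times> (F - {0}). (fst u + snd u, fst u * snd u) = v} +
          card {z \<in> F2 - {0}. (z + z ^ 2 ^ s, z * z ^ 2 ^ s) = v}) * \<psi> v = 2 * \<psi> v"
      using card_sum_product_fibres[of \<sigma> s p] v(2,3) unfolding v(1) F_def F2_def by simp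
  qed simp
  also have "\<dots> = 2 * (\<Sum>p\<in>F - {0}. \<Sum>\<sigma>\<in>F. trace_character s ((A + B * inverse p) * \<sigma>))"
    by (subst sum.swap) (simp add: \<psi>_def sum.cartesian_product case_prod_beta flip: sum_distrib_left)
  also have "(\<Sum>p\<in>F - {0}. \<Sum>\<sigma>\<in>F. trace_character s ((A + B * inverse p) * \<sigma>)) =
      (\<Sum>p\<in>F - {0}. if p = B * inverse A then 2 ^ s else 0)"
  proof (rule sum.cong)
    fix p assume p: "p \<in> F - {0}"
    then have "A + B * inverse p = 0 \<longleftrightarrow> p = B * inverse A"
      using AB by (auto simp: add_eq_0_iff_char2[OF char2] field_simps)
    then show "(\<Sum>\<sigma>\<in>F. trace_character s ((A + B * inverse p) * \<sigma>)) =
        (if p = B * inverse A then 2 ^ s else 0)"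
      unfolding F_def using p AB s
      by (subst sum_trace_character[OF char2]) (auto simp: F_def intro!: closed)
  qed simp
  also have "\<dots> = 2 ^ s"
    using fin AB by (auto simp: sum.delta' F_def intro!: closed)
  finally show ?thesis
    by simp
qed

end

section \<open>The Stepanov--Bombieri auxiliary function\<close>

definition polys_over :: "'k::field set \<Rightarrow> nat \<Rightarrow> 'k poly set" where
  "polys_over F n = {p. (\<forall>i. coeff p i \<in> F) \<and> degree p < n}"

text \<open>The induction splits off the constant coefficient. It starts at \<open>Suc 0\<close>
  because \<open>degree 0 = 0\<close> makes \<open>polys_over F 0\<close> empty.\<close>

lemma card_polys_over:
  assumes "finite F" "0 \<in> F"
  shows "finite (polys_over F (Suc n)) \<and> card (polys_over F (Suc n)) = card F ^ Suc n"
proof (induction n)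
  case 0
  have "polys_over F (Suc 0) = (\<lambda>a. [:a:]) ` F"
  proof (intro equalityI subsetI)
    fix p assume "p \<in> polys_over F (Suc 0)"
    then have "p = [:coeff p 0:]" "coeff p 0 \<in> F"
      by (auto simp: polys_over_def intro: degree_eq_zeroE)
    then show "p \<in> (\<lambda>a. [:a:]) ` F"
      by blast
  qed (use assms in \<open>auto simp: polys_over_def coeff_pCons split: nat.splits\<close>)
  moreover have "inj_on (\<lambda>a. [:a:]) F"
    by (auto simp: inj_on_def)
  ultimately show ?case
    using assms by (simp add: card_image)
next
  case (Suc n)
  have "polys_over F (Suc (Suc n)) = (\<lambda>(a, p). pCons a p) ` (F \<times> polys_over F (Suc n))"
  proof (intro equalityI subsetI)
    fix p assume p: "p \<in> polys_over F (Suc (Suc n))"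
    obtain a q where q: "p = pCons a q"
      by (rule pCons_cases)
    have "a \<in> F" "\<forall>i. coeff q i \<in> F"
      using p unfolding q polys_over_def
      by (auto simp: coeff_pCons dest: spec[of _ 0] spec[of _ "Suc _"])
    moreover have "degree q < Suc n"
      using p unfolding q polys_over_def by (cases "q = 0") auto
    ultimately show "p \<in> (\<lambda>(a, p). pCons a p) ` (F \<times> polys_over F (Suc n))"
      by (auto simp: q polys_over_def)
  next
    fix p assume "p \<in> (\<lambda>(a, p). pCons a p) ` (F \<times> polys_over F (Suc n))"
    then show "p \<in> polys_over F (Suc (Suc n))"
      by (auto simp: polys_over_def coeff_pCons degree_pCons_eq_if split: nat.splits)
  qed
  moreover have "inj_on (\<lambda>(a, p). pCons a p) (F \<times> polys_over F (Suc n))"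
    by (auto simp: inj_on_def)
  ultimately show ?case
    using Suc.IH assms by (simp add: card_image card_cartesian_product)
qed

text \<open>
  A pair \<open>(a, b)\<close> of polynomials stands for the function \<open>a + b Y\<close> on the curve \<open>Y\<^sup>2 + x Y = w(x)\<close>
  with \<open>deg w = 3\<close>. At its single point at infinity, \<open>x\<close> and \<open>Y\<close> have poles of order 2 and 3, and
  \<open>low D\<close> says that the pole order of the function is less than \<open>D\<close>.
\<close>

definition low :: "nat \<Rightarrow> 'k::field poly \<times> 'k poly \<Rightarrow> bool" where
  "low D v \<longleftrightarrow> (fst v \<noteq> 0 \<longrightarrow> 2 * degree (fst v) < D) \<and> (snd v \<noteq> 0 \<longrightarrow> 2 * degree (snd v) + 3 < D)"

lemma low_0: "low D 0"
  by (simp add: low_def)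

lemma low_mono: "low D v \<Longrightarrow> D \<le> D' \<Longrightarrow> low D' v"
  by (auto simp: low_def)

lemma low_add:
  assumes "low D v" "low D w"
  shows "low D (v + w)"
proof -
  have "2 * degree (p + q) + k < D"
    if "p \<noteq> 0 \<longrightarrow> 2 * degree p + k < D" "q \<noteq> 0 \<longrightarrow> 2 * degree q + k < D" "p + q \<noteq> 0"
    for p q :: "'a poly" and k
    using that degree_add_le_max[of p q] by (cases "p = 0"; cases "q = 0") (auto simp: max_def split: if_splits)
  from this[of "fst v" 0 "fst w"] this[of "snd v" 3 "snd w"] assms show ?thesis
    by (simp add: low_def)
qed

lemma low_sum: "(\<And>j. j \<in> J \<Longrightarrow> low D (v j)) \<Longrightarrow> low D (\<Sum>j\<in>J. v j)"
  by (induction J rule: infinite_finite_induct) (auto simp: low_0 low_add)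

text \<open>
  The curve is the Artin--Schreier curve \<open>y\<^sup>2 + y = A x + B / x\<close> with \<open>Y = x y\<close>. Below,
  \<open>q\<^sub>0 = 2 ^ h\<close> and \<open>Y ^ q\<^sub>0 = x ^ (q\<^sub>0 - 1) Y + G(x)\<close> holds on the curve.
\<close>

locale auxiliary_function =
  fixes F :: "'k::field set" and G w :: "'k poly" and r h :: nat
  assumes char2: "CHAR('k) = 2"
    and q: "2 ^ h = 4 * r" and r: "r \<ge> 2"
    and F_finite: "finite F" and F_01: "0 \<in> F" "1 \<in> F"
    and F_add: "\<And>x y. x \<in> F \<Longrightarrow> y \<in> F \<Longrightarrow> x + y \<in> F"
    and F_mult: "\<And>x y. x \<in> F \<Longrightarrow> y \<in> F \<Longrightarrow> x * y \<in> F"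
    and G_coeff: "\<And>i. coeff G i \<in> F" and G_degree: "degree G = 6 * r"
    and w_coeff: "\<And>i. coeff w i \<in> F" and w_degree: "degree w \<le> 3"
begin

abbreviation q0 :: nat where "q0 \<equiv> 4 * r"
text \<open>The \<open>N\<close> functions \<open>1, ..., x ^ M\<close> and
  \<open>Y, ..., x ^ (2 * r) * Y\<close> have pole orders 0, 2, 3, ..., \<open>4 * r + 3\<close>,
  each once.\<close>

abbreviation M :: nat where "M \<equiv> 2 * r + 1"
abbreviation N :: nat where "N \<equiv> 4 * r + 3"

text \<open>
  The index \<open>j\<close> stands for the function \<open>u\<close> equal to \<open>x ^ j\<close> for \<open>j \<le> M\<close> and to
  \<open>x ^ (j - M - 1) Y\<close> otherwise; \<open>weight j\<close> is its pole order. The two maps below send a function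
  \<open>v\<close> to \<open>v u ^ q\<^sub>0\<close> and to \<open>v ^ q\<^sub>0 u'\<close>, where \<open>u'\<close> arises from \<open>u\<close> by \<open>Y \<mapsto> Y + x\<close>. At a point
  with \<open>x \<in> F\<^sub>2\<^sub>h\<close> and trace one, \<open>u ^ (q\<^sub>0\<^sup>2) = u'\<close>, so the second is the \<open>q\<^sub>0\<close>-th power of the first.
\<close>

definition weight :: "nat \<Rightarrow> nat" where
  "weight j = (if j \<le> M then 2 * j else 2 * (j - Suc M) + 3)"

fun frobenius_term :: "nat \<Rightarrow> 'k poly \<times> 'k poly \<Rightarrow> 'k poly \<times> 'k poly" where
  "frobenius_term j (a, b) =
     (if j \<le> M then (monom 1 (j * q0) * a, monom 1 (j * q0) * b)
      else (monom 1 ((j - Suc M) * q0) * (a * G + b * monom 1 (q0 - 1) * w),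
            monom 1 ((j - Suc M) * q0) * (a * monom 1 (q0 - 1) + b * (G + monom 1 q0))))"

fun conjugate_term :: "nat \<Rightarrow> 'k poly \<times> 'k poly \<Rightarrow> 'k poly \<times> 'k poly" where
  "conjugate_term j (a, b) =
     (let p = a ^ q0 + b ^ q0 * G; t = b ^ q0 * monom 1 (q0 - 1)
      in if j \<le> M then (monom 1 j * p, monom 1 j * t)
         else (monom 1 (j - Suc M) * (monom 1 1 * p + w * t), monom 1 (j - Suc M) * p))"

text \<open>Pole order at most \<open>2 * r + 1\<close>, with as many free coefficients. Being below
  \<open>q0\<close>, it keeps the pole orders of the terms \<open>v u ^ q0\<close> in disjoint
  intervals of length \<open>q0\<close>.\<close>

definition coefficient_space :: "('k poly \<times> 'k poly) set" where
  "coefficient_space = polys_over F (Suc r) \<times> polys_over F r"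

section \<open>Pole orders and nonvanishing of the auxiliary function\<close>

lemma inj_on_weight: "inj_on weight {..<N}"
  by (rule inj_onI) (auto simp: weight_def split: if_splits; presburger)

text \<open>The factor \<open>u ^ q0\<close> adds \<open>weight j * q0\<close> to the pole order of
  \<open>v\<close>, which is less than \<open>q0\<close>.\<close>

lemma low_frobenius_term:
  assumes "v \<in> coefficient_space"
  shows "low ((weight j + 1) * q0) (frobenius_term j v)"
proof -
  obtain a b where v: "v = (a, b)" by (cases v)
  have a: "degree a \<le> r" and b: "degree b \<le> r - 1"
    using assms by (auto simp: v coefficient_space_def polys_over_def)
  note deg_mult = order.trans[OF degree_mult_le add_mono]
  show ?thesis
  proof (cases "j \<le> M")
    case True
    have "degree (monom 1 (j * q0) * a) \<le> j * q0 + r" "degree (monom 1 (j * q0) * b) \<le> j * q0 + (r - 1)"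
      by (intro deg_mult degree_monom_le a b)+
    moreover have "frobenius_term j v = (monom 1 (j * q0) * a, monom 1 (j * q0) * b)"
      "(weight j + 1) * q0 = 2 * (j * q0) + 4 * r"
      using True by (simp_all add: v weight_def algebra_simps)
    ultimately show ?thesis
      using r unfolding low_def by (simp only: fst_conv snd_conv) linarith
  next
    case False
    define i where "i = j - Suc M"
    define P where "P = a * G + b * monom 1 (q0 - 1) * w"
    define R where "R = a * monom 1 (q0 - 1) + b * (G + monom 1 q0)"
    have "degree (a * G) \<le> r + 6 * r" "degree (b * monom 1 (q0 - 1) * w) \<le> (r - 1) + (q0 - 1) + 3"
      using G_degree by (intro deg_mult degree_monom_le a b w_degree; simp)+
    then have "degree P \<le> 7 * r"
      unfolding P_def using r by (intro degree_add_le) auto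
    then have 1: "degree (monom 1 (i * q0) * P) \<le> i * q0 + 7 * r"
      by (intro deg_mult degree_monom_le)
    have "degree (G + monom 1 q0) \<le> 6 * r"
      using G_degree by (intro degree_add_le order.trans[OF degree_monom_le]) auto
    then have "degree (b * (G + monom 1 q0)) \<le> (r - 1) + 6 * r"
      by (intro deg_mult b)
    moreover have "degree (a * monom 1 (q0 - 1)) \<le> r + (q0 - 1)"
      by (intro deg_mult degree_monom_le a)
    ultimately have "degree R \<le> 7 * r - 1"
      unfolding R_def using r by (intro degree_add_le) auto
    then have 2: "degree (monom 1 (i * q0) * R) \<le> i * q0 + (7 * r - 1)"
      by (intro deg_mult degree_monom_le)
    have "frobenius_term j v = (monom 1 (i * q0) * P, monom 1 (i * q0) * R)"
      using False by (simp add: v i_def P_def R_def)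
    moreover have "weight j = 2 * i + 3"
      using False by (simp add: weight_def i_def)
    then have "(weight j + 1) * q0 = 2 * (i * q0) + 16 * r"
      by (simp add: algebra_simps)
    ultimately show ?thesis
      using r 1 2 unfolding low_def by (simp only: fst_conv snd_conv) linarith
  qed
qed

text \<open>Multiplying by a power of \<open>x\<close> only shifts degrees. With a factor
  \<open>Y ^ q0\<close>, the leading term of \<open>G\<close> survives: in the first component if
  \<open>a \<noteq> 0\<close>, in the second if \<open>a = 0\<close>. Its degree matches the pole
  order \<open>3 * q0 = 2 * (6 * r)\<close>.\<close>

lemma not_low_frobenius_term:
  assumes "v \<in> coefficient_space" "v \<noteq> 0"
  shows "\<not> low (weight j * q0) (frobenius_term j v)"
proof -
  obtain a b where v: "v = (a, b)" by (cases v)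
  have a: "degree a \<le> r" and b: "degree b \<le> r - 1"
    using assms by (auto simp: v coefficient_space_def polys_over_def)
  have nz: "a \<noteq> 0 \<or> b \<noteq> 0"
    using assms(2) by (auto simp: v zero_prod_def)
  have G0: "G \<noteq> 0"
    using G_degree r by auto
  note deg_mult = order.trans[OF degree_mult_le add_mono]
  have shift: "monom 1 n * p \<noteq> 0 \<and> degree (monom 1 n * p) = n + degree p" if "p \<noteq> 0" for p :: "'k poly" and n
    using that by (simp add: degree_mult_eq degree_monom_eq monom_eq_0_iff)
  show ?thesis
  proof (cases "j \<le> M")
    case True
    then show ?thesis
      using nz shift[of a "j * q0"] shift[of b "j * q0"] by (auto simp: v low_def weight_def)
  next
    case False
    define i where "i = j - Suc M"
    define P where "P = a * G + b * monom 1 (q0 - 1) * w"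
    define R where "R = a * monom 1 (q0 - 1) + b * (G + monom 1 q0)"
    have "weight j = 2 * i + 3"
      using False by (simp add: weight_def i_def)
    then have wt: "weight j * q0 = 2 * (i * q0) + 12 * r"
      by (simp add: algebra_simps)
    have eq: "frobenius_term j v = (monom 1 (i * q0) * P, monom 1 (i * q0) * R)"
      using False by (simp add: v i_def P_def R_def)
    have "degree (b * monom 1 (q0 - 1) * w) \<le> (r - 1) + (q0 - 1) + 3"
      by (intro deg_mult degree_monom_le b w_degree)
    \<comment> \<open>The sum is \<open>5 * r + 1\<close>, so \<open>r \<ge> 2\<close> enters
      here.\<close>
    also have "\<dots> < 6 * r"
      using r by simp
    finally have d: "degree (b * monom 1 (q0 - 1) * w) < 6 * r" .
    show ?thesis
    proof (cases "a = 0")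
      case False
      have "degree P = degree (a * G)"
        unfolding P_def using d False G0 G_degree by (intro degree_add_eq_left) (simp add: degree_mult_eq)
      then have "degree P \<ge> 6 * r"
        using False G0 G_degree by (simp add: degree_mult_eq)
      moreover from this have "P \<noteq> 0"
        using r by auto
      ultimately show ?thesis
        using shift[of P "i * q0"] unfolding low_def wt eq by simp
    next
      case True
      have "degree (G + monom 1 q0) = 6 * r"
        using r G_degree by (subst degree_add_eq_left) (simp_all add: degree_monom_eq)
      moreover from this have "G + monom 1 q0 \<noteq> 0"
        using r by auto
      ultimately have "degree R \<ge> 6 * r" "R \<noteq> 0"
        using nz True by (auto simp: R_def degree_mult_eq)
      then show ?thesis
        using shift[of R "i * q0"] unfolding low_def wt eq by simp
    qed
  qed
qed

lemma frobenius_term_0: "frobenius_term j 0 = 0"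
  by (simp add: zero_prod_def)

text \<open>The nonzero term of largest weight \<open>k\<close>, unique as weights are distinct, has
  pole order at least \<open>weight k * q0\<close>; all others stay below and cannot cancel
  it.\<close>

lemma sum_frobenius_term_nonzero:
  assumes v: "\<And>j. j < N \<Longrightarrow> v j \<in> coefficient_space" and "\<exists>j<N. v j \<noteq> 0"
  shows "(\<Sum>j<N. frobenius_term j (v j)) \<noteq> 0"
proof
  assume sum0: "(\<Sum>j<N. frobenius_term j (v j)) = 0"
  define J where "J = {j. j < N \<and> v j \<noteq> 0}"
  have J: "finite J" "J \<noteq> {}"
    using assms(2) by (auto simp: J_def)
  then have "Max (weight ` J) \<in> weight ` J"
    by (intro Max_in) auto
  then obtain k where k: "k \<in> J" "Max (weight ` J) = weight k"
    by auto
  have less: "weight j < weight k" if "j \<in> J" "j \<noteq> k" for j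
  proof -
    have "weight j \<le> weight k"
      using J that by (simp flip: k(2))
    moreover have "weight j \<noteq> weight k"
      using that k(1) inj_on_weight by (auto simp: J_def inj_on_def)
    ultimately show ?thesis by simp
  qed
  have "(\<Sum>j\<in>J. frobenius_term j (v j)) = (\<Sum>j<N. frobenius_term j (v j))"
    by (rule sum.mono_neutral_left) (auto simp: J_def frobenius_term_0)
  then have "frobenius_term k (v k) = - (\<Sum>j\<in>J - {k}. frobenius_term j (v j))"
    using J k(1) sum0 by (simp add: sum.remove eq_neg_iff_add_eq_0)
  moreover have "low (weight k * q0) (\<Sum>j\<in>J - {k}. frobenius_term j (v j))"
  proof (rule low_sum)
    fix j assume j: "j \<in> J - {k}"
    show "low (weight k * q0) (frobenius_term j (v j))"
      using less[of j] j
      by (intro low_mono[OF low_frobenius_term[OF v]] mult_right_mono) (auto simp: J_def)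
  qed
  ultimately have "low (weight k * q0) (frobenius_term k (v k))"
    by (simp add: low_def)
  then show False
    using not_low_frobenius_term[of "v k" k] v[of k] k(1) by (auto simp: J_def)
qed

section \<open>Degree bounds for the conjugate terms and the box principle\<close>

lemma coeff_in_F_mult: "(\<And>i. coeff p i \<in> F) \<Longrightarrow> (\<And>i. coeff p' i \<in> F) \<Longrightarrow> coeff (p * p') i \<in> F"
proof -
  have "(\<And>i. i \<in> I \<Longrightarrow> f i \<in> F) \<Longrightarrow> sum f I \<in> F" for f :: "nat \<Rightarrow> 'k" and I
    by (induction I rule: infinite_finite_induct) (auto intro: F_01 F_add)
  then show "(\<And>i. coeff p i \<in> F) \<Longrightarrow> (\<And>i. coeff p' i \<in> F) \<Longrightarrow> coeff (p * p') i \<in> F"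
    by (simp add: coeff_mult F_mult)
qed

lemma coeff_in_F_power: "(\<And>i. coeff p i \<in> F) \<Longrightarrow> coeff (p ^ n) i \<in> F"
proof (induction n arbitrary: i)
  case 0
  then show ?case using F_01 by (simp add: one_pCons coeff_pCons split: nat.splits)
next
  case (Suc n)
  then show ?case by (auto intro: coeff_in_F_mult)
qed

lemma coeff_in_F_monom: "coeff (monom 1 n) i \<in> F"
  using F_01 by simp

text \<open>The pole order of \<open>v ^ q0 u'\<close> is at most
  \<open>(2 * r + 1) * q0 + (4 * r + 3) = 8 * r ^ 2 + 8 * r + 3\<close>, which bounds the degrees of
  the two components as stated.\<close>

lemma conjugate_term_bound:
  assumes "v \<in> coefficient_space" "j < N"
  shows "conjugate_term j v \<in> polys_over F (4 * r\<^sup>2 + 4 * r + 2) \<times> polys_over F (4 * r\<^sup>2 + 4 * r + 1)"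
proof -
  obtain a b where v: "v = (a, b)" by (cases v)
  have a: "degree a \<le> r" and b: "degree b \<le> r - 1"
    and ab: "\<And>i. coeff a i \<in> F" "\<And>i. coeff b i \<in> F"
    using assms by (auto simp: v coefficient_space_def polys_over_def)
  note deg_mult = order.trans[OF degree_mult_le add_mono]
  note closed = coeff_in_F_mult coeff_in_F_power coeff_in_F_monom F_add G_coeff w_coeff ab
  define p where "p = a ^ q0 + b ^ q0 * G"
  define t where "t = b ^ q0 * monom 1 (q0 - 1)"
  have coeffs: "coeff p i \<in> F" "coeff t i \<in> F" for i
    unfolding p_def t_def coeff_add by (intro closed)+
  have aq: "degree (a ^ q0) \<le> 4 * r\<^sup>2"
    using order.trans[OF degree_power_le mult_right_mono[OF a], of q0]
    by (simp add: power2_eq_square mult_ac)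
  have bq: "degree (b ^ q0) \<le> 4 * r\<^sup>2 - 4 * r"
    using order.trans[OF degree_power_le mult_right_mono[OF b], of q0]
    by (simp add: power2_eq_square algebra_simps)
  have rr: "4 * r \<le> 4 * r\<^sup>2"
    by (simp add: power2_eq_square)
  have "degree (b ^ q0 * G) \<le> (4 * r\<^sup>2 - 4 * r) + 6 * r"
    by (intro deg_mult bq) (simp add: G_degree)
  then have p: "degree p \<le> 4 * r\<^sup>2 + 2 * r"
    unfolding p_def using aq rr by (intro degree_add_le) auto
  have "degree t \<le> (4 * r\<^sup>2 - 4 * r) + (q0 - 1)"
    unfolding t_def by (intro deg_mult bq degree_monom_le)
  then have t: "degree t \<le> 4 * r\<^sup>2 - 1"
    using r rr by simp
  show ?thesis
  proof (cases "j \<le> M")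
    case True
    have "degree (monom 1 j * p) \<le> M + (4 * r\<^sup>2 + 2 * r)" "degree (monom 1 j * t) \<le> M + (4 * r\<^sup>2 - 1)"
      using p t True by (intro deg_mult order.trans[OF degree_monom_le]; simp)+
    moreover have "coeff (monom 1 j * p) i \<in> F" "coeff (monom 1 j * t) i \<in> F" for i
      by (intro closed coeffs)+
    moreover have "conjugate_term j v = (monom 1 j * p, monom 1 j * t)"
      using True by (simp add: v Let_def p_def t_def)
    ultimately show ?thesis
      using r rr by (simp add: polys_over_def)
  next
    case False
    define i where "i = j - Suc M"
    have i: "i \<le> 2 * r"
      using assms(2) by (simp add: i_def)
    have "degree (monom 1 1 * p) \<le> 1 + (4 * r\<^sup>2 + 2 * r)"
      by (intro deg_mult p degree_monom_le)
    moreover have "degree (w * t) \<le> 3 + (4 * r\<^sup>2 - 1)"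
      by (intro deg_mult t w_degree)
    ultimately have "degree (monom 1 1 * p + w * t) \<le> 4 * r\<^sup>2 + 2 * r + 1"
      using r rr by (intro degree_add_le) auto
    then have "degree (monom 1 i * (monom 1 1 * p + w * t)) \<le> 2 * r + (4 * r\<^sup>2 + 2 * r + 1)"
      using i by (intro deg_mult order.trans[OF degree_monom_le])
    moreover have "degree (monom 1 i * p) \<le> 2 * r + (4 * r\<^sup>2 + 2 * r)"
      using i p by (intro deg_mult order.trans[OF degree_monom_le])
    moreover have "coeff (monom 1 1 * p + w * t) n \<in> F" for n
      unfolding coeff_add by (intro closed coeffs)
    then have "coeff (monom 1 i * (monom 1 1 * p + w * t)) n \<in> F" "coeff (monom 1 i * p) n \<in> F" for n
      by (intro closed coeffs; simp)+
    moreover have "conjugate_term j v = (monom 1 i * (monom 1 1 * p + w * t), monom 1 i * p)"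
      using False by (simp add: v Let_def p_def t_def i_def)
    ultimately show ?thesis
      by (simp add: polys_over_def)
  qed
qed

text \<open>Only the \<open>q0\<close>-th power of \<open>v\<close> enters, and \<open>q0\<close> is
  a power of the characteristic. Additivity turns a collision in the box principle into a
  zero.\<close>

lemma conjugate_term_add: "conjugate_term j (v + v') = conjugate_term j v + conjugate_term j v'"
proof -
  have "(p + p') ^ q0 = p ^ q0 + p' ^ q0" for p p' :: "'k poly"
    using frobenius_poly_add[OF char2, of p p' h] by (simp add: q)
  then show ?thesis
    by (cases v; cases v') (simp add: Let_def algebra_simps)
qed

lemma coefficient_space_add:
  "v \<in> coefficient_space \<Longrightarrow> v' \<in> coefficient_space \<Longrightarrow> v + v' \<in> coefficient_space"
  using r by (auto simp: coefficient_space_def polys_over_def less_Suc_eq_le degree_add_le degree_add_less F_add)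

text \<open>
  Dirichlet's box principle: there are \<open>(2r + 1)(4r + 3)\<close> free coefficients but only
  \<open>8r\<^sup>2 + 8r + 3\<close> linear conditions.
\<close>

lemma auxiliary_exists:
  "\<exists>v. (\<forall>j<N. v j \<in> coefficient_space) \<and> (\<exists>j<N. v j \<noteq> 0) \<and>
     (\<Sum>j<N. conjugate_term j (v j)) = 0"
proof -
  define V where "V = PiE {..<N} (\<lambda>_. coefficient_space)"
  define C where "C = polys_over F (4 * r\<^sup>2 + 4 * r + 2) \<times> polys_over F (4 * r\<^sup>2 + 4 * r + 1)"
  define S where "S v = (\<Sum>j<N. conjugate_term j (v j))" for v :: "nat \<Rightarrow> 'k poly \<times> 'k poly"
  have cF: "card F \<ge> 2"
    using F_finite F_01 card_mono[of F "{0, 1}"] by simp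
  have fin_C: "finite C"
    using card_polys_over[OF F_finite F_01(1)] by (simp add: C_def)
  have card_C: "card C = card F ^ (8 * r\<^sup>2 + 8 * r + 3)"
    using card_polys_over[OF F_finite F_01(1), of "4 * r\<^sup>2 + 4 * r + 1"]
      card_polys_over[OF F_finite F_01(1), of "4 * r\<^sup>2 + 4 * r"]
    by (simp add: C_def card_cartesian_product algebra_simps eval_nat_numeral flip: power_add power_Suc)
  have "card coefficient_space = card F ^ (2 * r + 1)"
    using card_polys_over[OF F_finite F_01(1), of r] card_polys_over[OF F_finite F_01(1), of "r - 1"] r
    by (simp add: coefficient_space_def card_cartesian_product mult_2 flip: power_add)
  then have "card V = card F ^ ((2 * r + 1) * N)"
    by (simp only: V_def card_PiE[OF finite_lessThan] prod_constant card_lessThan power_mult)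
  \<comment> \<open>The exponents differ by \<open>2 * r\<close>.\<close>
  also have "\<dots> > card C"
    unfolding card_C using cF r by (intro power_strict_increasing) (auto simp: algebra_simps power2_eq_square)
  finally have card: "card C < card V" .
  have "S ` V \<subseteq> C"
  proof (rule image_subsetI)
    fix v assume "v \<in> V"
    then have terms: "conjugate_term j (v j) \<in> C" if "j < N" for j
      using that conjugate_term_bound[of "v j" j] by (auto simp: V_def C_def)
    have "0 \<in> C"
      by (auto simp: C_def zero_prod_def polys_over_def F_01)
    moreover have "x + y \<in> C" if "x \<in> C" "y \<in> C" for x y
      using that by (auto simp: C_def polys_over_def degree_add_less F_add)
    ultimately have "sum f I \<in> C" if "\<And>j. j \<in> I \<Longrightarrow> f j \<in> C" for f and I :: "nat set"
      using that by (induction I rule: infinite_finite_induct) auto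
    from this[of "{..<N}"] terms show "S v \<in> C"
      by (simp add: S_def)
  qed
  then have "card (S ` V) < card V"
    using card card_mono[OF fin_C] by (meson le_less_trans)
  then obtain v v' where vv: "v \<in> V" "v' \<in> V" "v \<noteq> v'" "S v = S v'"
    using pigeonhole[of S V] by (auto simp: inj_on_def)
  have self: "x + x = 0" for x :: "'k poly \<times> 'k poly"
    using uminus_CHAR_2[of "fst x"] uminus_CHAR_2[of "snd x"] char2
    by (simp add: prod_eq_iff eq_neg_iff_add_eq_0 [symmetric])
  \<comment> \<open>In characteristic two this sum is the difference of the colliding families: not
    identically zero, but with image zero.\<close>
  define u where "u j = v j + v' j" for j
  have "\<exists>j<N. v j \<noteq> v' j"
    using vv(1-3) PiE_ext[of v "{..<N}" "\<lambda>_. coefficient_space" v'] by (auto simp: V_def)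
  then have "\<exists>j<N. u j \<noteq> 0"
    unfolding u_def by (metis self add_left_cancel)
  moreover have "\<forall>j<N. u j \<in> coefficient_space"
    using vv(1,2) by (auto simp: u_def V_def intro!: coefficient_space_add)
  moreover have "(\<Sum>j<N. conjugate_term j (u j)) = S v + S v'"
    by (simp add: u_def conjugate_term_add sum.distrib S_def)
  ultimately show ?thesis
    using vv(4) self by auto
qed

section \<open>Vanishing at the points with trace one\<close>

definition eval_at :: "'k \<Rightarrow> 'k \<Rightarrow> 'k poly \<times> 'k poly \<Rightarrow> 'k" where
  "eval_at x Y v = poly (fst v) x + poly (snd v) x * Y"

lemma eval_at_sum: "eval_at x Y (\<Sum>j\<in>J. v j) = (\<Sum>j\<in>J. eval_at x Y (v j))"
  by (simp add: eval_at_def fst_sum snd_sum poly_sum sum.distrib sum_distrib_right)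

text \<open>The \<open>q0\<close>-th power of \<open>v u ^ q0\<close> is
  \<open>v ^ q0 u ^ (q0 * q0)\<close>, and the hypotheses on \<open>x\<close> and \<open>Y\<close>
  turn \<open>u ^ (q0 * q0)\<close> into \<open>u'\<close>. The curve equation reduces products to
  the form \<open>a + b Y\<close>.\<close>

lemma eval_frobenius_term:
  assumes x: "x ^ (q0 * q0) = x"
    and Y: "Y * Y = x * Y + poly w x" "Y ^ q0 = x ^ (q0 - 1) * Y + poly G x" "(Y ^ q0) ^ q0 = Y + x"
  shows "eval_at x Y (frobenius_term j v) ^ q0 = eval_at x Y (conjugate_term j v)"
proof -
  obtain a b where v: "v = (a, b)" by (cases v)
  have frob: "(z + z') ^ q0 = z ^ q0 + z' ^ q0" for z z' :: 'k
    using frobenius_add[OF char2, of z z' h] by (simp add: q)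
  have xi: "((x ^ (i * q0))) ^ q0 = x ^ i" for i
  proof -
    have "((x ^ (i * q0))) ^ q0 = (x ^ (q0 * q0)) ^ i"
      by (simp add: mult_ac flip: power_mult)
    then show ?thesis by (simp only: x)
  qed
  define p' where "p' = a ^ q0 + b ^ q0 * G"
  define t' where "t' = b ^ q0 * monom 1 (q0 - 1)"
  define p where "p = poly p' x"
  define t where "t = poly t' x"
  have ab: "(poly a x + poly b x * Y) ^ q0 = p + t * Y"
    by (simp only: frob power_mult_distrib Y(2) p_def t_def p'_def t'_def poly_monom poly_add poly_mult poly_power)
      (simp add: algebra_simps)
  show ?thesis
  proof (cases "j \<le> M")
    case True
    have "eval_at x Y (frobenius_term j v) = x ^ (j * q0) * (poly a x + poly b x * Y)"
      using True by (simp add: v eval_at_def poly_monom algebra_simps)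
    then have "eval_at x Y (frobenius_term j v) ^ q0 = x ^ j * (p + t * Y)"
      by (simp only: power_mult_distrib xi ab)
    also have "x ^ j * (p + t * Y) = eval_at x Y (conjugate_term j v)"
    proof -
      have "conjugate_term j v = (monom 1 j * p', monom 1 j * t')"
        using True by (simp add: v Let_def p'_def t'_def)
      then show ?thesis
        by (simp add: eval_at_def poly_monom p_def t_def algebra_simps)
    qed
    finally show ?thesis .
  next
    case False
    define i where "i = j - Suc M"
    define P where "P = a * G + b * monom 1 (q0 - 1) * w"
    define R where "R = a * monom 1 (q0 - 1) + b * (G + monom 1 q0)"
    have xq: "x * x ^ (q0 - 1) = x ^ q0"
      using r by (subst power_eq_if[of x q0]) simp
    have "(poly a x + poly b x * Y) * Y ^ q0 =
        poly a x * poly G x + poly a x * x ^ (q0 - 1) * Y + poly b x * poly G x * Y +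
        poly b x * x ^ (q0 - 1) * (Y * Y)"
      unfolding Y(2) by (simp add: algebra_simps)
    also have "\<dots> = poly a x * poly G x + poly b x * x ^ (q0 - 1) * poly w x +
        (poly a x * x ^ (q0 - 1) + poly b x * (poly G x + x * x ^ (q0 - 1))) * Y"
      unfolding Y(1) by (simp add: algebra_simps)
    finally have PR: "poly P x + poly R x * Y = (poly a x + poly b x * Y) * Y ^ q0"
      by (simp only: P_def R_def poly_add poly_mult poly_monom xq mult_1_left)
    have "frobenius_term j v = (monom 1 (i * q0) * P, monom 1 (i * q0) * R)"
      using False by (simp add: v i_def P_def R_def)
    then have "eval_at x Y (frobenius_term j v) = x ^ (i * q0) * (poly P x + poly R x * Y)"
      by (simp only: eval_at_def fst_conv snd_conv poly_mult poly_monom mult_1_left distrib_left mult.assoc)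
    also note PR
    finally have "eval_at x Y (frobenius_term j v) =
        x ^ (i * q0) * ((poly a x + poly b x * Y) * Y ^ q0)" .
    then have "eval_at x Y (frobenius_term j v) ^ q0 = x ^ i * ((p + t * Y) * (Y + x))"
      by (simp only: power_mult_distrib xi ab Y(3))
    also have "(p + t * Y) * (Y + x) = x * p + t * (Y * Y + x * Y) + p * Y"
      by (simp add: algebra_simps)
    \<comment> \<open>\<open>Y\<close> and \<open>Y + x\<close> are the two points over
      \<open>x\<close>; their product is the constant term of the curve equation.\<close>
    also have "Y * Y + x * Y = poly w x"
      unfolding Y(1) by (simp add: add_self_char2[OF char2] add_add_self_char2[OF char2] add_ac)
    also have "x ^ i * (x * p + t * poly w x + p * Y) = eval_at x Y (conjugate_term j v)"
    proof -
      have "conjugate_term j v = (monom 1 i * (monom 1 1 * p' + w * t'), monom 1 i * p')"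
        using False by (simp add: v Let_def p'_def t'_def i_def)
      then show ?thesis
        by (simp add: eval_at_def poly_monom p_def t_def algebra_simps)
    qed
    finally show ?thesis .
  qed
qed

text \<open>At the points over \<open>S\<close>, the \<open>q0\<close>-th power of the nonzero
  function \<open>\<Psi>\<close> is a value of the conjugate sum, hence zero. Vanishing at both
  points over \<open>x\<close> makes both components vanish at \<open>x\<close>, and a nonzero
  component has few roots.\<close>

lemma common_zero_bound:
  assumes zero: "\<And>x. x \<in> S \<Longrightarrow> x \<noteq> 0 \<and> x ^ (q0 * q0) = x \<and>
      (\<exists>Y. \<forall>Y'\<in>{Y, Y + x}. Y' * Y' = x * Y' + poly w x \<and> Y' ^ q0 = x ^ (q0 - 1) * Y' + poly G x \<and>
         (Y' ^ q0) ^ q0 = Y' + x)"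
  shows "card S \<le> 8 * r\<^sup>2 + 8 * r"
proof -
  obtain v where v: "\<And>j. j < N \<Longrightarrow> v j \<in> coefficient_space" "\<exists>j<N. v j \<noteq> 0"
      "(\<Sum>j<N. conjugate_term j (v j)) = 0"
    using auxiliary_exists by blast
  define \<Psi> where "\<Psi> = (\<Sum>j<N. frobenius_term j (v j))"
  have nz: "\<Psi> \<noteq> 0"
    unfolding \<Psi>_def using v by (intro sum_frobenius_term_nonzero)
  \<comment> \<open>The largest weight is \<open>2 * M + 1\<close>. Half of
    \<open>(4 * r + 4) * q0\<close> is the degree bound below.\<close>
  have "low ((2 * M + 2) * q0) \<Psi>"
    unfolding \<Psi>_def
  proof (rule low_sum)
    fix j assume j: "j \<in> {..<N}"
    then have "weight j \<le> 2 * M + 1"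
      by (auto simp: weight_def)
    then show "low ((2 * M + 2) * q0) (frobenius_term j (v j))"
      using j v(1) by (intro low_mono[OF low_frobenius_term] mult_right_mono) auto
  qed
  then have deg: "fst \<Psi> \<noteq> 0 \<Longrightarrow> degree (fst \<Psi>) < 8 * r\<^sup>2 + 8 * r"
      "snd \<Psi> \<noteq> 0 \<Longrightarrow> degree (snd \<Psi>) < 8 * r\<^sup>2 + 8 * r"
    by (auto simp: low_def power2_eq_square algebra_simps)
  have vanish: "poly (fst \<Psi>) x = 0 \<and> poly (snd \<Psi>) x = 0" if xS: "x \<in> S" for x
  proof -
    have x: "x \<noteq> 0" "x ^ (q0 * q0) = x"
      using zero[OF xS] by auto
    obtain Y where Y: "\<forall>Y'\<in>{Y, Y + x}. Y' * Y' = x * Y' + poly w x \<and>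
        Y' ^ q0 = x ^ (q0 - 1) * Y' + poly G x \<and> (Y' ^ q0) ^ q0 = Y' + x"
      using zero[OF xS] by blast
    have "eval_at x Y' \<Psi> = 0" if "Y' \<in> {Y, Y + x}" for Y'
    proof -
      have "eval_at x Y' \<Psi> ^ 2 ^ h = (\<Sum>j<N. eval_at x Y' (frobenius_term j (v j)) ^ 2 ^ h)"
        unfolding \<Psi>_def eval_at_sum by (rule frobenius_sum[OF char2])
      also have "\<dots> = (\<Sum>j<N. eval_at x Y' (conjugate_term j (v j)))"
        unfolding q using Y that x(2) by (intro sum.cong eval_frobenius_term) auto
      also have "\<dots> = 0"
        unfolding eval_at_sum[symmetric] v(3) by (simp add: eval_at_def)
      finally show ?thesis by simp
    qed
    from this[of Y] this[of "Y + x"]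
    have *: "poly (fst \<Psi>) x + poly (snd \<Psi>) x * Y = 0"
        "poly (fst \<Psi>) x + poly (snd \<Psi>) x * (Y + x) = 0"
      by (simp_all add: eval_at_def)
    \<comment> \<open>The values at the two points differ by the second component times
      \<open>x\<close>, and \<open>x \<noteq> 0\<close>.\<close>
    from *(2) have "(poly (fst \<Psi>) x + poly (snd \<Psi>) x * Y) + poly (snd \<Psi>) x * x = 0"
      by (simp only: distrib_left add.assoc)
    with * show ?thesis
      using x(1) by simp
  qed
  have "card S \<le> degree P" if "P \<noteq> 0" "\<And>x. x \<in> S \<Longrightarrow> poly P x = 0" for P
  proof -
    have "card S \<le> card {x. poly P x = 0}"
      using that by (intro card_mono poly_roots_finite) auto
    also have "\<dots> \<le> degree P"
      using that(1) by (rule card_poly_roots_bound)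
    finally show ?thesis .
  qed
  from this[of "fst \<Psi>"] this[of "snd \<Psi>"] deg nz vanish show ?thesis
    by (fastforce simp: prod_eq_iff)
qed

end

section \<open>The Weil bound\<close>

context
  fixes dummy :: "'k::alg_closed_field itself"
  assumes char2: "CHAR('k) = 2"
begin

text \<open>If \<open>y ^ 2 + y = f\<close> and \<open>f\<close> has trace one, then
  \<open>y ^ 2 ^ s = y + 1\<close>, so \<open>Y = x * y\<close> meets the hypotheses of
  \<open>common_zero_bound\<close>. Twice the bound there is \<open>q0 ^ 2 + 4 * q0\<close>.\<close>

lemma card_trace_nonzero_le:
  fixes A B :: 'k
  assumes h: "h \<ge> 3" and s: "s = 2 * h"
    and AB: "A \<in> frobenius_fixed s" "B \<in> frobenius_fixed s" "A \<noteq> 0" "B \<noteq> 0"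
  shows "2 * card {x \<in> frobenius_fixed s - {0}. trace_poly s (A * x + B * inverse x) \<noteq> 0}
           \<le> 2 ^ s + 4 * 2 ^ h"
proof -
  obtain k where k: "h = k + 3"
    using h le_Suc_ex[of 3 h] by (auto simp: add.commute)
  \<comment> \<open>This is \<open>2 ^ (h - 2)\<close>; \<open>h \<ge> 3\<close> ensures
    \<open>r \<ge> 2\<close>.\<close>
  define r :: nat where "r = 2 * 2 ^ k"
  have q: "(2::nat) ^ h = 4 * r" and half: "(2::nat) ^ (h - 1) = 2 * r"
    by (simp_all add: r_def k power_add)
  have r: "r \<ge> 2"
    by (simp add: r_def)
  have Q: "(2::nat) ^ s = 4 * r * (4 * r)"
    unfolding s mult_2 power_add q ..
  \<comment> \<open>At nonzero \<open>x\<close> this is \<open>x ^ 2 ^ h\<close> times the partial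
    trace \<open>trace_poly h (A * x + B / x)\<close>; the factor clears the poles at zero.\<close>
  define G where "G = (\<Sum>i<h. monom (A ^ 2 ^ i) (2 ^ h + 2 ^ i) + monom (B ^ 2 ^ i) (2 ^ h - 2 ^ i))"
  define w where "w = monom A 3 + monom B 1"
  have closed_power: "x ^ n \<in> frobenius_fixed s" if "x \<in> frobenius_fixed s" for x :: 'k and n
    using that by (induction n) (auto intro: frobenius_fixed_1[OF char2] frobenius_fixed_mult[OF char2])
  have closed_sum: "(\<And>i. i \<in> I \<Longrightarrow> f i \<in> frobenius_fixed s) \<Longrightarrow> sum f I \<in> frobenius_fixed s"
    for f :: "nat \<Rightarrow> 'k" and I
    by (induction I rule: infinite_finite_induct)
      (auto intro: frobenius_fixed_0[OF char2] frobenius_fixed_add[OF char2])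
  have G_degree: "degree G = 6 * r"
  proof (rule antisym)
    have bound: "2 ^ h + 2 ^ i \<le> 6 * r" "2 ^ h - 2 ^ i \<le> 6 * r" if "i < h" for i
    proof -
      have "(2::nat) ^ i \<le> 2 ^ (h - 1)"
        using that by (intro power_increasing) auto
      then show "2 ^ h + 2 ^ i \<le> 6 * r" "2 ^ h - 2 ^ i \<le> 6 * r"
        unfolding q half by linarith+
    qed
    show "degree G \<le> 6 * r"
      unfolding G_def
      by (intro degree_sum_le degree_add_le order.trans[OF degree_monom_le]) (auto simp: bound)
    \<comment> \<open>Only the \<open>A\<close> term with \<open>i = h - 1\<close> reaches the
      degree \<open>2 ^ h + 2 ^ (h - 1) = 6 * r\<close>.\<close>
    have "coeff G (6 * r) = (\<Sum>i<h. if i = h - 1 then A ^ 2 ^ (h - 1) else 0)"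
      unfolding G_def coeff_sum
    proof (intro sum.cong)
      fix i assume i: "i \<in> {..<h}"
      have "2 ^ h + 2 ^ i = 6 * r \<longleftrightarrow> (2::nat) ^ i = 2 ^ (h - 1)"
        using q half by auto
      moreover have "2 ^ h - 2 ^ i \<noteq> 6 * r"
        using diff_le_self[of "2 ^ h" "2 ^ i"] q r by linarith
      ultimately show "coeff (monom (A ^ 2 ^ i) (2 ^ h + 2 ^ i) + monom (B ^ 2 ^ i) (2 ^ h - 2 ^ i)) (6 * r) =
          (if i = h - 1 then A ^ 2 ^ (h - 1) else 0)"
        by (auto simp: coeff_add)
    qed simp
    also have "\<dots> \<noteq> 0"
      using h AB by simp
    finally show "6 * r \<le> degree G"
      by (rule le_degree)
  qed
  interpret auxiliary_function "frobenius_fixed s :: 'k set" G w r h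
  proof
    show "finite (frobenius_fixed s :: 'k set)"
      using h s finite_frobenius_fixed[OF char2] by simp
    show "coeff G i \<in> frobenius_fixed s" for i
      unfolding G_def coeff_sum using AB
      by (intro closed_sum)
        (auto intro!: frobenius_fixed_add[OF char2] closed_power frobenius_fixed_0[OF char2])
    show "coeff w i \<in> frobenius_fixed s" for i
      using AB by (auto simp: w_def frobenius_fixed_0[OF char2])
    show "degree w \<le> 3"
      unfolding w_def by (intro degree_add_le order.trans[OF degree_monom_le]) auto
  qed (use q r char2 G_degree frobenius_fixed_0[OF char2] frobenius_fixed_1[OF char2]
        frobenius_fixed_add[OF char2] frobenius_fixed_mult[OF char2] in auto)
  define S where "S = {x \<in> frobenius_fixed s - {0}. trace_poly s (A * x + B * inverse x) \<noteq> 0}"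
  have "card S \<le> 8 * r\<^sup>2 + 8 * r"
  proof (rule common_zero_bound)
    fix x assume x: "x \<in> S"
    define f where "f = A * x + B * inverse x"
    have x0: "x \<noteq> 0" and xQ: "x ^ 2 ^ s = x" and tr: "trace_poly s f = 1"
      using x AB trace_poly_fixed_cases[OF char2, of f s]
      by (auto simp: S_def f_def frobenius_fixed_def frobenius_add[OF char2] power_mult_distrib power_inverse)
    have "degree [:f, 1, 1:] > 0"
      by simp
    then obtain y where "poly [:f, 1, 1:] y = 0"
      using alg_closed_imp_poly_has_root by blast
    then have y: "y\<^sup>2 + y = f"
      using add_eq_0_iff_char2[OF char2, of f "y * (1 + y)"] by (simp add: power2_eq_square algebra_simps)
    have G: "poly G x = x ^ 2 ^ h * trace_poly h f"
      unfolding G_def trace_poly_def poly_sum sum_distrib_left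
    proof (intro sum.cong)
      fix i assume "i \<in> {..<h}"
      then have "(2::nat) ^ i \<le> 2 ^ h"
        by (simp add: less_imp_le)
      then have "x ^ (2 ^ h - 2 ^ i) = x ^ 2 ^ h * inverse x ^ 2 ^ i"
        using x0 by (simp add: power_diff field_simps power_inverse)
      then show "poly (monom (A ^ 2 ^ i) (2 ^ h + 2 ^ i) + monom (B ^ 2 ^ i) (2 ^ h - 2 ^ i)) x =
          x ^ 2 ^ h * f ^ 2 ^ i"
        by (simp add: f_def poly_monom frobenius_add[OF char2] power_mult_distrib power_add algebra_simps)
    qed simp
    have w: "poly w x = x * x * f"
      using x0 by (simp add: w_def f_def poly_monom eval_nat_numeral algebra_simps)
    have main: "Y * Y = x * Y + poly w x \<and> Y ^ q0 = x ^ (q0 - 1) * Y + poly G x \<and> (Y ^ q0) ^ q0 = Y + x"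
      if z: "Y = x * z" "z\<^sup>2 + z = f" for Y z
    proof (intro conjI)
      have pow: "z ^ 2 ^ n = z + trace_poly n f" for n
        using trace_poly_artin_schreier[OF char2, of n z] z(2) add_add_self_char2[OF char2, of z "z ^ 2 ^ n"]
        by (simp add: add.commute)
      have "z * z = z + f"
        using z(2) add_add_self_char2[OF char2, of z "z * z"] by (simp add: power2_eq_square add.commute)
      then show "Y * Y = x * Y + poly w x"
        unfolding w z(1) by (simp add: mult_ac distrib_left)
      have "x ^ q0 = x ^ (q0 - 1) * x"
        using r by (subst power_eq_if[of x q0]) simp
      then show "Y ^ q0 = x ^ (q0 - 1) * Y + poly G x"
        using pow[of h] by (simp add: G q z(1) power_mult_distrib distrib_left)
      show "(Y ^ q0) ^ q0 = Y + x"
        using pow[of s] xQ by (simp add: z(1) Q tr power_mult_distrib distrib_left flip: power_mult)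
    qed
    \<comment> \<open>The other Artin--Schreier root gives the second point
      \<open>Y + x\<close>.\<close>
    have "(y + 1)\<^sup>2 + (y + 1) = f"
      using y by (simp add: frobenius_square_add[OF char2] add_self_char2[OF char2]
          add_add_self_char2[OF char2] add_ac)
    then have "\<forall>Y'\<in>{x * y, x * y + x}. Y' * Y' = x * Y' + poly w x \<and>
        Y' ^ q0 = x ^ (q0 - 1) * Y' + poly G x \<and> (Y' ^ q0) ^ q0 = Y' + x"
      using main[OF refl y] main[of "x * y + x" "y + 1"] by (auto simp only: distrib_left mult_1_right)
    then show "x \<noteq> 0 \<and> x ^ (q0 * q0) = x \<and>
      (\<exists>Y. \<forall>Y'\<in>{Y, Y + x}. Y' * Y' = x * Y' + poly w x \<and> Y' ^ q0 = x ^ (q0 - 1) * Y' + poly G x \<and>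
         (Y' ^ q0) ^ q0 = Y' + x)"
      using x0 xQ unfolding Q by blast
  qed
  then show ?thesis
    unfolding S_def Q q by (simp add: power2_eq_square)
qed

text \<open>The sum equals \<open>2 ^ (2 * h) - 1\<close> minus twice the number of nonzero
  \<open>x\<close> with trace one, hence is at least \<open>- 1 - 4 * 2 ^ h\<close>; the constant 5
  absorbs the 1.\<close>

lemma kloosterman_sum_lower:
  fixes A B :: 'k
  assumes h: "h \<ge> 3"
    and AB: "A \<in> frobenius_fixed (2 * h)" "B \<in> frobenius_fixed (2 * h)" "A \<noteq> 0" "B \<noteq> 0"
  shows "kloosterman_sum (2 * h) A B \<ge> - 5 * 2 ^ h"
proof -
  define F :: "'k set" where "F = frobenius_fixed (2 * h)"
  define S where "S = {x \<in> F - {0}. trace_poly (2 * h) (A * x + B * inverse x) \<noteq> 0}"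
  have fin: "finite F" and card: "card F = 2 ^ (2 * h)"
    using h finite_frobenius_fixed[OF char2] card_frobenius_fixed[OF char2] by (simp_all add: F_def)
  have "0 \<in> F"
    by (simp add: F_def frobenius_fixed_0[OF char2])
  then have card': "real (card (F - {0})) = 2 ^ (2 * h) - 1"
    using fin card by (simp add: of_nat_diff)
  have "kloosterman_sum (2 * h) A B = (\<Sum>x\<in>F - {0}. 1 - 2 * (if x \<in> S then 1 else 0))"
    unfolding kloosterman_sum_def F_def[symmetric]
    by (intro sum.cong) (auto simp: trace_character_def S_def)
  also have "\<dots> = real (card (F - {0})) - 2 * (\<Sum>x\<in>F - {0}. if x \<in> S then 1 else 0)"
    by (simp add: sum_subtractf sum_distrib_left)
  also have "(\<Sum>x\<in>F - {0}. if x \<in> S then 1 else 0) = real (card S)"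
    using fin 
    by (subst sum.inter_filter[symmetric]) (auto simp: S_def intro!: arg_cong[where f = card])
  finally have "kloosterman_sum (2 * h) A B = 2 ^ (2 * h) - 1 - 2 * real (card S)"
    using card' by simp
  moreover have "2 * card S \<le> 2 ^ (2 * h) + 4 * 2 ^ h"
    using card_trace_nonzero_le[OF h refl AB] by (simp add: S_def F_def)
  then have "real (2 * card S) \<le> real (2 ^ (2 * h) + 4 * 2 ^ h)"
    by (rule of_nat_mono)
  then have "2 * real (card S) \<le> 2 ^ (2 * h) + 4 * 2 ^ h"
    by simp
  moreover have "(1::real) \<le> 2 ^ h"
    by simp
  ultimately show ?thesis
    by linarith
qed

section \<open>Weil's bound from the quadratic recursion\<close>

theorem kloosterman_sum_bound:
  fixes A B :: 'k
  assumes s: "s \<ge> 1" and AB: "A \<in> frobenius_fixed s" "B \<in> frobenius_fixed s" "A \<noteq> 0" "B \<noteq> 0"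
  shows "\<bar>kloosterman_sum s A B\<bar> \<le> 2 * sqrt (2 ^ s)"
proof (rule ccontr)
  assume "\<not> ?thesis"
  then have gt: "\<bar>kloosterman_sum s A B\<bar> > 2 * sqrt (2 ^ s)"
    by simp
  have "4 * 2 ^ s = (2 * sqrt (2 ^ s :: real))\<^sup>2"
    by (simp add: power_mult_distrib)
  also have "\<dots> < \<bar>kloosterman_sum s A B\<bar>\<^sup>2"
    using gt by (intro power_strict_mono) auto
  finally have gt: "4 * 2 ^ s < (kloosterman_sum s A B)\<^sup>2"
    by simp
  define n where "n k = s * 2 ^ k" for k :: nat
  define \<kappa> where "\<kappa> k = kloosterman_sum (n k) A B" for k
  define Q :: "nat \<Rightarrow> real" where "Q k = 2 ^ n k" for k
  \<comment> \<open>The excess over the Weil bound. The recursion sends \<open>u\<close> to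
    \<open>u ^ 2 + 4 * u\<close>, so a positive excess at least quadruples.\<close>
  define u where "u k = (\<kappa> k)\<^sup>2 / Q k - 4" for k
  have n_Suc: "n (Suc k) = 2 * n k" for k
    by (simp add: n_def)
  have n_pos: "n k \<ge> 1" for k
    using s by (simp add: n_def)
  have mem: "A \<in> frobenius_fixed (n k)" "B \<in> frobenius_fixed (n k)" for k
    by (induction k) (use AB in \<open>auto simp: n_Suc frobenius_fixed_double[OF char2] n_def[of 0]\<close>)
  have \<kappa>_Suc: "\<kappa> (Suc k) = 2 * Q k - (\<kappa> k)\<^sup>2" for k
    unfolding \<kappa>_def n_Suc Q_def using n_pos mem AB by (intro kloosterman_sum_double[OF char2])
  have Q_Suc: "Q (Suc k) = (Q k)\<^sup>2" and Q_pos: "Q k > 0" for k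
    by (simp_all add: Q_def n_Suc power_mult mult.commute[of 2])
  have u_Suc: "u (Suc k) = (u k)\<^sup>2 + 4 * u k" for k
  proof -
    have "\<kappa> (Suc k) / Q k = - (u k + 2)"
      using Q_pos[of k] by (simp add: \<kappa>_Suc u_def field_simps)
    then have "(\<kappa> (Suc k))\<^sup>2 / Q (Suc k) = (u k + 2)\<^sup>2"
      by (simp only: Q_Suc power_divide[symmetric] power2_minus)
    then show ?thesis
      by (simp add: u_def[of "Suc k"] power2_eq_square algebra_simps)
  qed
  have u0: "u 0 > 0"
    using gt by (simp add: u_def Q_def \<kappa>_def n_def field_simps)
  have growth: "u k \<ge> 4 ^ k * u 0" for k
  proof (induction k)
    case (Suc k)
    have "4 ^ Suc k * u 0 \<le> 4 * u k"
      using Suc by simp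
    also have "\<dots> \<le> u (Suc k)"
      by (simp add: u_Suc)
    finally show ?case .
  qed simp
  have u_pos: "u k > 0" for k
    by (rule less_le_trans[OF _ growth]) (simp add: u0)
  \<comment> \<open>\<open>k \<ge> 2\<close> gives \<open>n k \<ge> 3\<close>, as the lower bound
    requires; 21 is \<open>5 ^ 2 - 4\<close>.\<close>
  have bound: "u (Suc k) \<le> 21" if "k \<ge> 2" for k
  proof -
    have "2 ^ 2 \<le> (2::nat) ^ k"
      using that by (intro power_increasing) auto
    then have "1 * 3 \<le> s * 2 ^ k"
      using s by (intro mult_mono) auto
    then have "- 5 * 2 ^ n k \<le> \<kappa> (Suc k)"
      unfolding \<kappa>_def n_Suc using mem[of "Suc k"] AB
      by (intro kloosterman_sum_lower) (auto simp: n_Suc n_def[of k])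
    \<comment> \<open>Since the sum is negative, the lower bound controls its absolute
      value.\<close>
    moreover have "\<kappa> (Suc k) < 0"
    proof -
      have "4 * Q k < (\<kappa> k)\<^sup>2"
        using u_pos[of k] Q_pos[of k] by (simp add: u_def field_simps)
      then show ?thesis
        using Q_pos[of k] by (simp add: \<kappa>_Suc)
    qed
    ultimately have "\<bar>\<kappa> (Suc k)\<bar> \<le> 5 * Q k"
      by (simp add: Q_def)
    then have "(\<kappa> (Suc k))\<^sup>2 \<le> (5 * Q k)\<^sup>2"
      using abs_le_square_iff[of "\<kappa> (Suc k)" "5 * Q k"] Q_pos[of k] by simp
    then show ?thesis
      using Q_pos[of k] by (simp add: u_def Q_Suc power_mult_distrib divide_le_eq)
  qed
  obtain m where m: "21 / u 0 < 4 ^ m"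
    using real_arch_pow[of 4 "21 / u 0"] by auto
  have "21 < 4 ^ m * u 0"
    using m u0 by (simp add: field_simps)
  also have "\<dots> \<le> 4 ^ (m + 3) * u 0"
    using u0 by (intro mult_right_mono power_increasing) auto
  also have "\<dots> \<le> u (Suc (m + 2))"
    using growth[of "m + 3"] by (simp add: numeral_3_eq_3)
  also have "\<dots> \<le> 21"
    by (rule bound) simp
  finally show False by simp
qed

text \<open>As \<open>inverse 0 = 0\<close>, the point \<open>x = 0\<close> contributes the extra 1.
  If \<open>A\<close> or \<open>B\<close> is zero, the sum vanishes by orthogonality, since
  inversion permutes the field.\<close>

lemma complete_kloosterman_sum_bound:
  fixes A B :: 'k
  assumes s: "s \<ge> 1" and AB: "A \<in> frobenius_fixed s" "B \<in> frobenius_fixed s" "A \<noteq> 0 \<or> B \<noteq> 0"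
  shows "\<bar>\<Sum>x\<in>frobenius_fixed s. trace_character s (A * x + B * inverse x)\<bar> \<le> 1 + 2 * sqrt (2 ^ s)"
proof (cases "A \<noteq> 0 \<and> B \<noteq> 0")
  case True
  have "(\<Sum>x\<in>frobenius_fixed s. trace_character s (A * x + B * inverse x)) = 1 + kloosterman_sum s A B"
    using finite_frobenius_fixed[OF char2 s] frobenius_fixed_0[OF char2, of s]
    by (subst sum.remove[of _ 0]) (auto simp: kloosterman_sum_def trace_character_def trace_poly_def power_0_left)
  then show ?thesis
    using kloosterman_sum_bound[OF s AB(1,2)] True by auto
next
  case False
  have "(\<Sum>x\<in>frobenius_fixed s. trace_character s (B * inverse x)) =
      (\<Sum>x\<in>frobenius_fixed s. trace_character s (B * x))"
    by (rule sum.reindex_bij_witness[of _ inverse inverse]) (auto simp: frobenius_fixed_inverse[OF char2])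
  then have "(\<Sum>x\<in>frobenius_fixed s. trace_character s (A * x + B * inverse x)) = 0"
    using False AB sum_trace_character[OF char2 s, of A] sum_trace_character[OF char2 s, of B] by auto
  then show ?thesis by simp
qed

end

section \<open>Sign vectors\<close>

context
  fixes t :: nat and dummy :: "'a::finite_field itself"
  assumes t: "t \<ge> 1" and card: "CARD('a) = 2 ^ t"
begin

section \<open>The given field inside its algebraic closure\<close>

lemma char_finite_field_2: "CHAR('a) = 2"
proof -
  have "CHAR('a) dvd 2 ^ t"
    using CHAR_dvd_CARD[where 'a='a] card by simp
  moreover have "prime CHAR('a)"
    by (rule prime_CHAR_semidom) (simp add: finite_imp_CHAR_pos)
  ultimately show ?thesis
    by (metis prime_dvd_power primes_dvd_imp_eq two_is_prime_nat)
qed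

lemma char_closure_2: "CHAR('a alg_closure) = 2"
  by (simp add: char_finite_field_2)

text \<open>The embedding is injective with image in the fixed field, and both sets have
  \<open>2 ^ t\<close> elements.\<close>

lemma range_to_ac: "range (to_ac :: 'a \<Rightarrow> 'a alg_closure) = frobenius_fixed t"
proof (rule card_seteq)
  show "finite (frobenius_fixed t :: 'a alg_closure set)"
    using finite_frobenius_fixed[OF char_closure_2] t by simp
  have "x ^ 2 ^ t = x" for x :: 'a
    using finite_field_power_card_eq_same[of x] card by simp
  then show "range (to_ac :: 'a \<Rightarrow> 'a alg_closure) \<subseteq> frobenius_fixed t"
    by (auto simp: frobenius_fixed_def simp flip: to_ac_power)
  show "card (frobenius_fixed t :: 'a alg_closure set) \<le> card (range (to_ac :: 'a \<Rightarrow> 'a alg_closure))"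
    using card_frobenius_fixed[OF char_closure_2] t by (simp add: card_image[OF inj_to_ac] card)
qed

lemma to_ac_mem_frobenius_fixed: "to_ac (x :: 'a) \<in> frobenius_fixed t"
  using range_to_ac by auto

lemma sign_trace_exponent: "(-1) ^ trace_exponent t (x :: 'a) = trace_character t (to_ac x)"
proof -
  have "to_ac (abs_trace t x) = trace_poly t (to_ac x)"
    by (simp add: abs_trace_def trace_poly_def to_ac_sum)
  then have "abs_trace t x = 0 \<longleftrightarrow> trace_poly t (to_ac x) = 0"
    by (metis to_ac_eq_0_iff)
  then show ?thesis
    by (simp add: trace_exponent_def trace_character_def)
qed

text \<open>Multiplying signs adds the arguments, so the inner product is a complete character sum
  with coefficients \<open>a + a'\<close> and \<open>b + b'\<close>, divided by
  \<open>2 ^ t\<close>. In characteristic two these are differences, not both zero for distinct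
  labels.\<close>

lemma sign_vector_inner_bound:
  fixes a b a' b' :: 'a
  assumes "(a, b) \<noteq> (a', b')"
  shows "\<bar>sign_vector t a b \<bullet> sign_vector t a' b'\<bar> \<le> (1 + 2 * sqrt (2 ^ t)) / 2 ^ t"
proof -
  let ?\<psi> = "\<lambda>x. trace_character t (to_ac (a + a') * x + to_ac (b + b') * inverse x)"
  have "sign_vector t a b \<bullet> sign_vector t a' b' = (\<Sum>\<xi>\<in>UNIV. ?\<psi> (to_ac \<xi>) / 2 ^ t)"
    unfolding inner_vec_def
  proof (rule sum.cong)
    fix \<xi> :: 'a
    let ?x = "a * \<xi> + b * inverse \<xi>" and ?x' = "a' * \<xi> + b' * inverse \<xi>"
    have "?\<psi> (to_ac \<xi>) = trace_character t (to_ac ?x + to_ac ?x')"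
      by (simp add: algebra_simps)
    also have "\<dots> = trace_character t (to_ac ?x) * trace_character t (to_ac ?x')"
      by (intro trace_character_add[OF char_closure_2] to_ac_mem_frobenius_fixed)
    finally show "sign_vector t a b $ \<xi> \<bullet> sign_vector t a' b' $ \<xi> = ?\<psi> (to_ac \<xi>) / 2 ^ t"
      by (simp add: sign_vector_def sign_trace_exponent card)
  qed simp
  also have "\<dots> = (\<Sum>x\<in>range to_ac. ?\<psi> x) / 2 ^ t"
    by (subst sum.reindex[OF inj_to_ac]) (simp add: sum_divide_distrib)
  finally have "\<bar>sign_vector t a b \<bullet> sign_vector t a' b'\<bar> =
      \<bar>\<Sum>x\<in>frobenius_fixed t. ?\<psi> x\<bar> / 2 ^ t"
    by (simp only: range_to_ac abs_divide) simp
  also have "\<dots> \<le> (1 + 2 * sqrt (2 ^ t)) / 2 ^ t"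
  proof (intro divide_right_mono)
    have "a + a' \<noteq> 0 \<or> b + b' \<noteq> 0"
      using assms by (simp add: add_eq_0_iff_char2[OF char_finite_field_2])
    then show "\<bar>\<Sum>x\<in>frobenius_fixed t. ?\<psi> x\<bar> \<le> 1 + 2 * sqrt (2 ^ t)"
      by (intro complete_kloosterman_sum_bound[OF char_closure_2] t to_ac_mem_frobenius_fixed)
        (simp del: to_ac_add)
  qed simp
  finally show ?thesis .
qed

text \<open>The inner product is a single coordinate, of absolute value
  \<open>1 / sqrt (2 ^ t)\<close>.\<close>

lemma axis_sign_vector_inner_bound:
  "\<bar>axis \<xi> 1 \<bullet> sign_vector t a (b :: 'a)\<bar> \<le> (1 + 2 * sqrt (2 ^ t)) / 2 ^ t"
proof -
  have "\<bar>axis \<xi> 1 \<bullet> sign_vector t a b\<bar> = 1 / sqrt (2 ^ t)"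
    by (simp add: inner_axis' sign_vector_def card abs_mult power_abs)
  also have "\<dots> = sqrt (2 ^ t) / 2 ^ t"
    by (simp add: sqrt_divide_self_eq inverse_eq_divide)
  also have "\<dots> \<le> (1 + 2 * sqrt (2 ^ t)) / 2 ^ t"
    by (intro divide_right_mono) auto
  finally show ?thesis .
qed

end

section \<open>Coherence of the dictionary\<close>

theorem theoremA1:
  fixes t d m :: nat
    and \<phi> :: "nat \<Rightarrow> real ^ 'a::finite_field"
  assumes "t \<ge> 1"
    and "d = 2 ^ t"
    and "CARD('a) = d"
    and "d \<le> m" and "m \<le> d + d ^ 2"
    and "sign_dictionary t m \<phi>"
  shows "coherence m \<phi> \<le> (1 + 2 * sqrt (real d)) / real d \<and>
         (1 + 2 * sqrt (real d)) / real d = 2 / sqrt (real d) + 1 / real d"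
proof
  have card: "CARD('a) = 2 ^ t"
    using assms by simp
  have d: "real d = 2 ^ t"
    using assms by simp
  show "(1 + 2 * sqrt (real d)) / real d = 2 / sqrt (real d) + 1 / real d"
    using sqrt_divide_self_eq[of "real d"] by (simp add: add_divide_distrib inverse_eq_divide flip: times_divide_eq_right)
  obtain L :: "('a \<times> 'a) set" and \<sigma> where
    \<sigma>: "bij_betw \<sigma> {1..m} (Sum_Type.Plus UNIV L)" and
    \<phi>: "\<And>i. i \<in> {1..m} \<Longrightarrow> \<phi> i = (case \<sigma> i of Inl \<xi> \<Rightarrow> axis \<xi> 1 | Inr (a, b) \<Rightarrow> sign_vector t a b)"
    using assms(6) unfolding sign_dictionary_def by blast
  have bound: "\<bar>\<phi> i \<bullet> \<phi> j\<bar> \<le> (1 + 2 * sqrt (2 ^ t)) / 2 ^ t"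
    if ij: "i \<in> {1..m}" "j \<in> {1..m}" "i \<noteq> j" for i j
  proof -
    \<comment> \<open>Distinct indices have distinct labels, which is what the bounds use; the
      vectors themselves may coincide.\<close>
    have ne: "\<sigma> i \<noteq> \<sigma> j"
      using inj_on_eq_iff[OF bij_betw_imp_inj_on[OF \<sigma>] ij(1,2)] ij(3) by blast
    note axis_bound = axis_sign_vector_inner_bound[OF assms(1) card]
    show ?thesis
    proof (cases "\<sigma> i")
      case i: (Inl \<xi>)
      then show ?thesis
        using axis_bound[of \<xi>] ne \<phi>[OF ij(1)] \<phi>[OF ij(2)]
        by (cases "\<sigma> j") (auto simp: inner_axis_axis)
    next
      case i: (Inr l)
      then show ?thesis
      proof (cases "\<sigma> j")
        case (Inl \<xi>)
        then show ?thesis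
          using i axis_bound[of \<xi>] \<phi>[OF ij(1)] \<phi>[OF ij(2)] by (cases l) (simp add: inner_commute)
      next
        case (Inr l')
        then show ?thesis
          using i ne \<phi>[OF ij(1)] \<phi>[OF ij(2)] sign_vector_inner_bound[OF assms(1) card]
          by (cases l; cases l') auto
      qed
    qed
  qed
  \<comment> \<open>Hence \<open>m \<ge> 2\<close>, and the maximum is taken over a nonempty
    set.\<close>
  have "2 \<le> d"
    using assms(1,2) power_increasing[of 1 t "2::nat"] by simp
  then have "\<bar>\<phi> 1 \<bullet> \<phi> 2\<bar> \<in> {\<bar>\<phi> i \<bullet> \<phi> j\<bar> | i j. i \<in> {1..m} \<and> j \<in> {1..m} \<and> i \<noteq> j}"
    using assms(4) by (intro CollectI exI[of _ 1] exI[of _ 2]) auto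
  moreover have "finite {\<bar>\<phi> i \<bullet> \<phi> j\<bar> | i j. i \<in> {1..m} \<and> j \<in> {1..m} \<and> i \<noteq> j}"
    by (rule finite_subset[of _ "(\<lambda>(i, j). \<bar>\<phi> i \<bullet> \<phi> j\<bar>) ` ({1..m} \<times> {1..m})"]) auto
  ultimately show "coherence m \<phi> \<le> (1 + 2 * sqrt (real d)) / real d"
    unfolding coherence_def d using bound by (subst Max_le_iff) auto
qed

end
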